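(* Let $\mathbb{G}$ be a compact Kac algebra. If $x\in L^\infty(\mathbb{G})$ satisfies $\Delta(x)\in L^\infty(\mathbb{G})\otimes L^\infty(\mathbb{G})$ (the C$^*$-algebraic minimal tensor product), then $x\in C(\mathbb{G})$.
   Context: A compact Kac algebra is a compact quantum group $\mathbb{G}$ whose antipode is bounded, $S=R=S^{-1}$; equivalently, the Haar state is a trace. $C(\mathbb{G})$ is the reduced (unital) C$^*$-algebra of $\mathbb{G}$ acting on the GNS space $L^2(\mathbb{G})$ of the Haar state, $L^\infty(\mathbb{G})=C(\mathbb{G})''$, and $\Delta:L^\infty(\mathbb{G})\to L^\infty(\mathbb{G})\overline\otimes L^\infty(\mathbb{G})$ is the coproduct. The minimal tensor product $L^\infty(\mathbb{G})\otimes L^\infty(\mathbb{G})$ is identified with the norm closure of the algebraic tensor product inside the von Neumann algebra tensor product $L^\infty(\mathbb{G})\overline\otimes L^\infty(\mathbb{G})$. *)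

theory Defs
  imports "HOL-Analysis.Analysis"
begin

section \<open>Complex Hilbert spaces\<close>

class complex_vector = real_vector +
  fixes scaleC :: "complex \<Rightarrow> 'a \<Rightarrow> 'a" (infixr "*\<^sub>C" 75)
  assumes scaleC_add_right: "c *\<^sub>C (x + y) = c *\<^sub>C x + c *\<^sub>C y"
    and scaleC_add_left: "(c + d) *\<^sub>C x = c *\<^sub>C x + d *\<^sub>C x"
    and scaleC_scaleC: "c *\<^sub>C d *\<^sub>C x = (c * d) *\<^sub>C x"
    and scaleC_of_real: "of_real r *\<^sub>C x = r *\<^sub>R x"

class complex_normed_vector = complex_vector + real_normed_vector +
  assumes norm_scaleC: "norm (c *\<^sub>C x) = cmod c * norm x"

text \<open>
  The norm is the one of the underlying real inner product space, whose inner product is the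
  real part of the complex one. The complex inner product is linear in its second argument.
\<close>
class chilbert_space = complex_vector + real_inner + complete_space +
  fixes cinner :: "'a \<Rightarrow> 'a \<Rightarrow> complex"
  assumes cinner_add_right: "cinner x (y + z) = cinner x y + cinner x z"
    and cinner_scaleC_right: "cinner x (c *\<^sub>C y) = c * cinner x y"
    and cinner_commute: "cinner x y = cnj (cinner y x)"
    and Re_cinner: "Re (cinner x y) = inner x y"

lemma cinner_self: "cinner x x = of_real ((norm x)\<^sup>2)"
  for x :: "'a::chilbert_space"
proof -
  have "Im (cinner x x) = 0"
    using arg_cong[OF cinner_commute[of x x], of Im] by simp
  then show ?thesis
    by (simp add: complex_eq_iff Re_cinner power2_norm_eq_inner)
qed

lemma cinner_scaleC_left: "cinner (c *\<^sub>C x) y = cnj c * cinner x y"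
  for x y :: "'a::chilbert_space"
  by (metis cinner_commute cinner_scaleC_right complex_cnj_mult)

instance chilbert_space \<subseteq> complex_normed_vector
proof
  fix c :: complex and x :: 'a
  have "of_real ((norm (c *\<^sub>C x))\<^sup>2) = cinner (c *\<^sub>C x) (c *\<^sub>C x)"
    by (simp only: cinner_self)
  also have "\<dots> = (cnj c * c) * of_real ((norm x)\<^sup>2)"
    by (simp only: cinner_self[symmetric] cinner_scaleC_left cinner_scaleC_right mult.assoc
        mult.left_commute)
  also have "\<dots> = of_real ((cmod c * norm x)\<^sup>2)"
    by (simp only: mult.commute[of "cnj c"] complex_norm_square[symmetric] power_mult_distrib
        of_real_mult of_real_power)
  finally have "(norm (c *\<^sub>C x))\<^sup>2 = (cmod c * norm x)\<^sup>2"
    by (simp only: of_real_eq_iff)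
  then show "norm (c *\<^sub>C x) = cmod c * norm x"
    by (simp add: power2_eq_iff_nonneg)
qed

lemma bounded_linear_scaleC: "bounded_linear (\<lambda>x::'a::complex_normed_vector. c *\<^sub>C x)"
proof (rule bounded_linear_intro[where ?K = "cmod c"])
  fix x y :: 'a and r :: real
  show "c *\<^sub>C (x + y) = c *\<^sub>C x + c *\<^sub>C y"
    by (rule scaleC_add_right)
  show "c *\<^sub>C r *\<^sub>R x = r *\<^sub>R c *\<^sub>C x"
    by (metis scaleC_of_real scaleC_scaleC mult.commute)
  show "norm (c *\<^sub>C x) \<le> norm x * cmod c"
    by (simp add: norm_scaleC)
qed

global_interpretation complex_vector:
  vector_space "scaleC :: complex \<Rightarrow> 'a \<Rightarrow> 'a::complex_vector"
  defines cspan = complex_vector.span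
  by unfold_locales
    (simp_all add: scaleC_add_right scaleC_add_left scaleC_scaleC
      scaleC_of_real[of 1, simplified])

instantiation prod :: (complex_vector, complex_vector) complex_vector
begin

definition scaleC_prod_def: "c *\<^sub>C p = (c *\<^sub>C fst p, c *\<^sub>C snd p)"

instance
  by standard
    (simp_all add: scaleC_prod_def scaleC_add_right scaleC_add_left scaleC_scaleC
      scaleC_of_real scaleR_prod_def)

end


section \<open>Bounded operators\<close>

text \<open>
  Bounded operators are the complex-linear elements of the library type of bounded real-linear
  maps, which carries the operator norm.
\<close>

instantiation blinfun :: (real_normed_vector, complex_normed_vector) complex_normed_vector
begin

lift_definition scaleC_blinfun :: "complex \<Rightarrow> ('a \<Rightarrow>\<^sub>L 'b) \<Rightarrow> ('a \<Rightarrow>\<^sub>L 'b)"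
  is "\<lambda>c T x. c *\<^sub>C T x"
  by (rule bounded_linear_compose[OF bounded_linear_scaleC])

instance
proof
  fix c d :: complex and r :: real and S T :: "'a \<Rightarrow>\<^sub>L 'b"
  show "c *\<^sub>C (S + T) = c *\<^sub>C S + c *\<^sub>C T"
    by transfer (simp add: scaleC_add_right)
  show "(c + d) *\<^sub>C T = c *\<^sub>C T + d *\<^sub>C T"
    by transfer (simp add: scaleC_add_left)
  show "c *\<^sub>C d *\<^sub>C T = (c * d) *\<^sub>C T"
    by transfer (simp add: scaleC_scaleC)
  show "of_real r *\<^sub>C T = r *\<^sub>R T"
    by transfer (simp add: scaleC_of_real)
  show "norm (c *\<^sub>C T) = cmod c * norm T"
  proof transfer
    fix c :: complex and f :: "'a \<Rightarrow> 'b"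
    assume f: "bounded_linear f"
    have "onorm (\<lambda>x. c *\<^sub>C f x) = onorm (\<lambda>x. cmod c *\<^sub>R f x)"
      by (simp add: onorm_def norm_scaleC)
    also have "\<dots> = cmod c * onorm f"
      using onorm_scaleR[OF f] by simp
    finally show "onorm (\<lambda>x. c *\<^sub>C f x) = cmod c * onorm f" .
  qed
qed

end

definition bounded_ops :: "('a::complex_normed_vector \<Rightarrow>\<^sub>L 'b::complex_normed_vector) set"
  where "bounded_ops = {T. \<forall>c x. blinfun_apply T (c *\<^sub>C x) = c *\<^sub>C blinfun_apply T x}"

definition adj :: "('a::chilbert_space \<Rightarrow>\<^sub>L 'b::chilbert_space) \<Rightarrow> ('b \<Rightarrow>\<^sub>L 'a)"
  where "adj T = (THE S. \<forall>x y. cinner (blinfun_apply T x) y = cinner x (blinfun_apply S y))"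

definition commutant :: "('a::chilbert_space \<Rightarrow>\<^sub>L 'a) set \<Rightarrow> ('a \<Rightarrow>\<^sub>L 'a) set"
  where "commutant X = {T \<in> bounded_ops. \<forall>S\<in>X. T o\<^sub>L S = S o\<^sub>L T}"

definition unital_cstar_algebra :: "('a::chilbert_space \<Rightarrow>\<^sub>L 'a) set \<Rightarrow> bool"
  where "unital_cstar_algebra A \<longleftrightarrow>
    A \<subseteq> bounded_ops \<and> id_blinfun \<in> A \<and>
    (\<forall>S\<in>A. \<forall>T\<in>A. S + T \<in> A) \<and> (\<forall>c. \<forall>T\<in>A. c *\<^sub>C T \<in> A) \<and>
    (\<forall>S\<in>A. \<forall>T\<in>A. S o\<^sub>L T \<in> A) \<and> (\<forall>T\<in>A. adj T \<in> A) \<and> closed A"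

definition unital_star_hom_on ::
    "('a::chilbert_space \<Rightarrow>\<^sub>L 'a) set \<Rightarrow>
      (('a \<Rightarrow>\<^sub>L 'a) \<Rightarrow> ('b::chilbert_space \<Rightarrow>\<^sub>L 'b)) \<Rightarrow> bool"
  where "unital_star_hom_on A \<phi> \<longleftrightarrow>
    \<phi> id_blinfun = id_blinfun \<and>
    (\<forall>S\<in>A. \<forall>T\<in>A. \<phi> (S + T) = \<phi> S + \<phi> T) \<and> (\<forall>c. \<forall>T\<in>A. \<phi> (c *\<^sub>C T) = c *\<^sub>C \<phi> T) \<and>
    (\<forall>S\<in>A. \<forall>T\<in>A. \<phi> (S o\<^sub>L T) = \<phi> S o\<^sub>L \<phi> T) \<and> (\<forall>T\<in>A. \<phi> (adj T) = adj (\<phi> T))"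


section \<open>Tensor products\<close>

text \<open>
  A Hilbert space tensor product of \<open>'a\<close> and \<open>'b\<close> is any Hilbert space \<open>'c\<close> with a bilinear map
  \<open>t\<close> (written \<open>x \<otimes> y\<close> below) satisfying the following; it is unique up to a unique unitary
  compatible with the bilinear maps.
\<close>
locale hilbert_tensor =
  fixes t :: "'a::chilbert_space \<Rightarrow> 'b::chilbert_space \<Rightarrow> 'c::chilbert_space"
  assumes add_left: "t (x + x') y = t x y + t x' y"
    and add_right: "t x (y + y') = t x y + t x y'"
    and scaleC_left: "t (c *\<^sub>C x) y = c *\<^sub>C t x y"
    and scaleC_right: "t x (c *\<^sub>C y) = c *\<^sub>C t x y"
    and cinner_tensor: "cinner (t x y) (t x' y') = cinner x x' * cinner y y'"
    and dense: "closure (cspan {t x y | x y. True}) = UNIV"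

text \<open>The operator \<open>S \<otimes> T\<close>:\<close>
definition tensor_op ::
    "('a::chilbert_space \<Rightarrow> 'b::chilbert_space \<Rightarrow> 'c::chilbert_space) \<Rightarrow>
      ('a \<Rightarrow>\<^sub>L 'a) \<Rightarrow> ('b \<Rightarrow>\<^sub>L 'b) \<Rightarrow> ('c \<Rightarrow>\<^sub>L 'c)"
  where "tensor_op t S T =
    (THE R. \<forall>x y. blinfun_apply R (t x y) = t (blinfun_apply S x) (blinfun_apply T y))"

text \<open>
  The minimal tensor product of two algebras of operators, realised as a norm closure inside the
  bounded operators on the tensor product Hilbert space (and hence, for von Neumann algebras,
  inside their von Neumann algebra tensor product).
\<close>
definition min_tensor ::
    "('a::chilbert_space \<Rightarrow> 'b::chilbert_space \<Rightarrow> 'c::chilbert_space) \<Rightarrow>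
      ('a \<Rightarrow>\<^sub>L 'a) set \<Rightarrow> ('b \<Rightarrow>\<^sub>L 'b) set \<Rightarrow> ('c \<Rightarrow>\<^sub>L 'c) set"
  where "min_tensor t A B = closure (cspan {tensor_op t a b | a b. a \<in> A \<and> b \<in> B})"

text \<open>
  For a *-homomorphism \<open>\<phi>\<close> on \<open>A\<close>, the maps \<open>\<phi> \<otimes> id\<close> and \<open>id \<otimes> \<phi>\<close> on the minimal tensor product
  of \<open>A\<close> with itself: the graph of the continuous extension is the closure of the graph of the
  algebraic tensor product of the maps. Here \<open>t\<close> is the tensor product on which the argument
  acts and \<open>t'\<close> the one on which the value acts.
\<close>
definition hom_tensor_id ::
    "('a::chilbert_space \<Rightarrow> 'a \<Rightarrow> 'c::chilbert_space) \<Rightarrow>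
      ('c \<Rightarrow> 'a \<Rightarrow> 'd::chilbert_space) \<Rightarrow> ('a \<Rightarrow>\<^sub>L 'a) set \<Rightarrow>
      (('a \<Rightarrow>\<^sub>L 'a) \<Rightarrow> ('c \<Rightarrow>\<^sub>L 'c)) \<Rightarrow> ('c \<Rightarrow>\<^sub>L 'c) \<Rightarrow> ('d \<Rightarrow>\<^sub>L 'd)"
  where "hom_tensor_id t t' A \<phi> X =
    (THE Y. (X, Y) \<in>
      closure (cspan {(tensor_op t a b, tensor_op t' (\<phi> a) b) | a b. a \<in> A \<and> b \<in> A}))"

definition id_tensor_hom ::
    "('a::chilbert_space \<Rightarrow> 'a \<Rightarrow> 'c::chilbert_space) \<Rightarrow>
      ('a \<Rightarrow> 'c \<Rightarrow> 'd::chilbert_space) \<Rightarrow> ('a \<Rightarrow>\<^sub>L 'a) set \<Rightarrow>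
      (('a \<Rightarrow>\<^sub>L 'a) \<Rightarrow> ('c \<Rightarrow>\<^sub>L 'c)) \<Rightarrow> ('c \<Rightarrow>\<^sub>L 'c) \<Rightarrow> ('d \<Rightarrow>\<^sub>L 'd)"
  where "id_tensor_hom t t' A \<phi> X =
    (THE Y. (X, Y) \<in>
      closure (cspan {(tensor_op t a b, tensor_op t' a (\<phi> b)) | a b. a \<in> A \<and> b \<in> A}))"

definition vector_state :: "'a::chilbert_space \<Rightarrow> ('a \<Rightarrow>\<^sub>L 'a) \<Rightarrow> complex"
  where "vector_state \<xi> T = cinner \<xi> (blinfun_apply T \<xi>)"

text \<open>The slices \<open>id \<otimes> h\<close> and \<open>h \<otimes> id\<close> by the vector state \<open>h\<close> of \<open>\<xi>\<close>:\<close>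
definition slice_right ::
    "('a::chilbert_space \<Rightarrow> 'b::chilbert_space \<Rightarrow> 'c::chilbert_space) \<Rightarrow>
      'b \<Rightarrow> ('c \<Rightarrow>\<^sub>L 'c) \<Rightarrow> ('a \<Rightarrow>\<^sub>L 'a)"
  where "slice_right t \<xi> X =
    (THE T. \<forall>x y. cinner x (blinfun_apply T y) = cinner (t x \<xi>) (blinfun_apply X (t y \<xi>)))"

definition slice_left ::
    "('a::chilbert_space \<Rightarrow> 'b::chilbert_space \<Rightarrow> 'c::chilbert_space) \<Rightarrow>
      'a \<Rightarrow> ('c \<Rightarrow>\<^sub>L 'c) \<Rightarrow> ('b \<Rightarrow>\<^sub>L 'b)"
  where "slice_left t \<xi> X =
    (THE T. \<forall>x y. cinner x (blinfun_apply T y) = cinner (t \<xi> x) (blinfun_apply X (t \<xi> y)))"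


section \<open>Compact quantum groups and compact Kac algebras\<close>

text \<open>
  A compact quantum group (in the sense of Woronowicz) given by its reduced C*-algebra \<open>A\<close>, the
  algebra \<open>C(G)\<close>, acting on the GNS space \<open>'h\<close> of the Haar state, the space \<open>L\<^sup>2(G)\<close>. The GNS
  vector is \<open>\<xi>\<close>, so that the Haar state is the vector state of \<open>\<xi>\<close>, and \<open>\<Delta>\<close> is the coproduct of
  \<open>A\<close> (its values outside \<open>A\<close> are irrelevant). The tensor product of \<open>'h\<close> with itself is given
  by \<open>t\<close>; \<open>tl\<close> and \<open>tr\<close> give the threefold tensor product bracketed to the left and to the
  right, identified by the associativity condition.
\<close>
locale compact_quantum_group =
  t: hilbert_tensor t + tl: hilbert_tensor tl + tr: hilbert_tensor tr
  for t :: "'h::chilbert_space \<Rightarrow> 'h \<Rightarrow> 'k::chilbert_space"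
    and tl :: "'k \<Rightarrow> 'h \<Rightarrow> 'l::chilbert_space"
    and tr :: "'h \<Rightarrow> 'k \<Rightarrow> 'l" +
  fixes A :: "('h \<Rightarrow>\<^sub>L 'h) set"
    and \<Delta> :: "('h \<Rightarrow>\<^sub>L 'h) \<Rightarrow> ('k \<Rightarrow>\<^sub>L 'k)"
    and \<xi> :: 'h
  assumes tensor_assoc: "tl (t x y) z = tr x (t y z)"
    and cstar: "unital_cstar_algebra A"
    and comult_hom: "unital_star_hom_on A \<Delta>"
    and comult_range: "a \<in> A \<Longrightarrow> \<Delta> a \<in> min_tensor t A A"
    and coassociative: "a \<in> A \<Longrightarrow> hom_tensor_id t tl A \<Delta> (\<Delta> a) = id_tensor_hom t tr A \<Delta> (\<Delta> a)"
    and cancellation_left: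
      "closure (cspan {\<Delta> a o\<^sub>L tensor_op t b id_blinfun | a b. a \<in> A \<and> b \<in> A}) = min_tensor t A A"
    and cancellation_right:
      "closure (cspan {\<Delta> a o\<^sub>L tensor_op t id_blinfun b | a b. a \<in> A \<and> b \<in> A}) = min_tensor t A A"
    and norm_GNS_vector: "norm \<xi> = 1"
    and cyclic: "closure {blinfun_apply a \<xi> | a. a \<in> A} = UNIV"
    and haar_right: "a \<in> A \<Longrightarrow> slice_right t \<xi> (\<Delta> a) = vector_state \<xi> a *\<^sub>C id_blinfun"
    and haar_left: "a \<in> A \<Longrightarrow> slice_left t \<xi> (\<Delta> a) = vector_state \<xi> a *\<^sub>C id_blinfun"

locale compact_kac_algebra = compact_quantum_group +
  assumes haar_trace: "a \<in> A \<Longrightarrow> b \<in> A \<Longrightarrow> vector_state \<xi> (a o\<^sub>L b) = vector_state \<xi> (b o\<^sub>L a)"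

definition L_infinity :: "('h::chilbert_space \<Rightarrow>\<^sub>L 'h) set \<Rightarrow> ('h \<Rightarrow>\<^sub>L 'h) set"
  where "L_infinity A = commutant (commutant A)"

text \<open>
  The multiplicative unitary \<open>W\<close>, determined by
  \<open>W\<^sup>* (a\<xi> \<otimes> b\<xi>) = \<Delta>(b)(a\<xi> \<otimes> \<xi>)\<close> for \<open>a, b \<in> A\<close>.
\<close>
definition mult_unitary ::
    "('h::chilbert_space \<Rightarrow> 'h \<Rightarrow> 'k::chilbert_space) \<Rightarrow> ('h \<Rightarrow>\<^sub>L 'h) set \<Rightarrow>
      (('h \<Rightarrow>\<^sub>L 'h) \<Rightarrow> ('k \<Rightarrow>\<^sub>L 'k)) \<Rightarrow> 'h \<Rightarrow> ('k \<Rightarrow>\<^sub>L 'k)"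
  where "mult_unitary t A \<Delta> \<xi> =
    (THE W. \<forall>a\<in>A. \<forall>b\<in>A.
      blinfun_apply W (blinfun_apply (\<Delta> b) (t (blinfun_apply a \<xi>) \<xi>)) =
        t (blinfun_apply a \<xi>) (blinfun_apply b \<xi>))"

text \<open>
  The coproduct of \<open>L\<^sup>\<infinity>(G)\<close>, \<open>x \<mapsto> W\<^sup>* (1 \<otimes> x) W\<close>, which is the unique normal extension of \<open>\<Delta>\<close>.
\<close>
definition coproduct ::
    "('h::chilbert_space \<Rightarrow> 'h \<Rightarrow> 'k::chilbert_space) \<Rightarrow> ('h \<Rightarrow>\<^sub>L 'h) set \<Rightarrow>
      (('h \<Rightarrow>\<^sub>L 'h) \<Rightarrow> ('k \<Rightarrow>\<^sub>L 'k)) \<Rightarrow> 'h \<Rightarrow> ('h \<Rightarrow>\<^sub>L 'h) \<Rightarrow> ('k \<Rightarrow>\<^sub>L 'k)"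
  where "coproduct t A \<Delta> \<xi> x =
    (let W = mult_unitary t A \<Delta> \<xi> in adj W o\<^sub>L tensor_op t id_blinfun x o\<^sub>L W)"

end

theory Submission
  imports Defs
begin

text \<open>
  The map \<open>V: a\<xi> \<mapsto> \<Delta>(a)(\<xi> \<otimes> \<xi>)\<close> extends to an isometry with \<open>\<Delta>(x) V = V x\<close>, so the compression
  \<open>E(X) = V\<^sup>* X V\<close> satisfies \<open>E(\<Delta>(x)) = x\<close>, and it suffices that \<open>E\<close> maps \<open>L\<^sup>\<infinity> \<otimes> L\<^sup>\<infinity>\<close> into \<open>A\<close>.
  On \<open>A \<otimes> A\<close> this follows from cancellation: since \<open>h\<close> is an invariant trace, \<open>E(m \<otimes> 1) = h(m) 1\<close>,
  hence \<open>E(\<Delta>(n)(m \<otimes> 1)) = h(m) n \<in> A\<close>. The same identity gives \<open>\<parallel>(1 \<otimes> m)V\<parallel> \<le> \<parallel>m\<xi>\<parallel>\<close>, and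
  likewise on the other leg. Thus \<open>E(a \<otimes> b) = ((a\<^sup>* \<otimes> 1)V)\<^sup>* (1 \<otimes> b)V\<close> depends norm continuously on
  the vectors \<open>a\<^sup>*\<xi>\<close> and \<open>b\<xi>\<close>, which can be approximated from \<open>A\<xi>\<close>; so \<open>E(a \<otimes> b) \<in> A\<close> for all
  \<open>a, b \<in> L\<^sup>\<infinity>\<close>.
\<close>

section \<open>Operators on Hilbert spaces\<close>

lemma closure_cspan_induct [consumes 1, case_names closed base zero add scale]:
  fixes S :: "'a::complex_normed_vector set"
  assumes "x \<in> closure (cspan S)" and "closed {x. P x}"
    and "\<And>s. s \<in> S \<Longrightarrow> P s" and "P 0"
    and "\<And>x y. P x \<Longrightarrow> P y \<Longrightarrow> P (x + y)" and "\<And>c x. P x \<Longrightarrow> P (c *\<^sub>C x)"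
  shows "P x"
proof -
  have "cspan S \<subseteq> {x. P x}"
  proof
    fix y assume "y \<in> cspan S"
    then show "y \<in> {x. P x}"
      by (induction rule: complex_vector.span_induct_alt) (use assms(3-6) in auto)
  qed
  then show ?thesis
    using closure_minimal[OF _ assms(2)] assms(1) by blast
qed

lemma closure_cspan_add:
  fixes S :: "'a::{complex_vector, real_normed_vector} set"
  assumes "x \<in> closure (cspan S)" and "y \<in> closure (cspan S)"
  shows "x + y \<in> closure (cspan S)"
proof -
  obtain p q where "\<And>n. p n \<in> cspan S" "p \<longlonglongrightarrow> x" "\<And>n. q n \<in> cspan S" "q \<longlonglongrightarrow> y"
    using assms unfolding closure_sequential by blast
  then have "(\<lambda>n. p n + q n) \<longlonglongrightarrow> x + y" "\<forall>n. p n + q n \<in> cspan S"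
    by (intro tendsto_add allI complex_vector.span_add; simp)+
  then show ?thesis
    unfolding closure_sequential by (intro exI[of _ "\<lambda>n. p n + q n"] conjI)
qed

text \<open>Continuity of scalar multiplication is a hypothesis so that the lemma also covers
  product spaces, where graphs of operators live and which carry only the class
  \<open>complex_vector\<close>.\<close>

lemma closure_cspan_scaleC_continuous:
  fixes S :: "'a::{complex_vector, real_normed_vector} set"
  assumes "continuous_on UNIV (scaleC c :: 'a \<Rightarrow> 'a)" and "x \<in> closure (cspan S)"
  shows "c *\<^sub>C x \<in> closure (cspan S)"
proof -
  have "scaleC c ` closure (cspan S) \<subseteq> closure (cspan S)"
    by (rule image_closure_subset[OF continuous_on_subset[OF assms(1)] closed_closure])
      (auto intro!: subsetD[OF closure_subset] complex_vector.span_scale)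
  then show ?thesis
    using assms(2) by blast
qed

lemma closure_cspan_scaleC:
  fixes S :: "'a::complex_normed_vector set"
  shows "x \<in> closure (cspan S) \<Longrightarrow> c *\<^sub>C x \<in> closure (cspan S)"
  by (rule closure_cspan_scaleC_continuous[OF linear_continuous_on[OF bounded_linear_scaleC]])

lemma closure_cspan_base: "x \<in> S \<Longrightarrow> x \<in> closure (cspan S)"
  for S :: "'a::{complex_vector, topological_space} set"
  using complex_vector.span_base closure_subset by blast

lemma scaleC_zero_left [simp]: "0 *\<^sub>C x = 0" and scaleC_one [simp]: "1 *\<^sub>C x = x"
  and scaleC_zero_right [simp]: "c *\<^sub>C 0 = 0"
  and scaleC_minus1: "(-1) *\<^sub>C x = - x"
  and scaleC_diff_right: "c *\<^sub>C (x - y) = c *\<^sub>C x - c *\<^sub>C y"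
  for x :: "'a::complex_vector"
  by (simp_all add: complex_vector.scale_right_diff_distrib)

lemma continuous_on_scaleC [continuous_intros]:
  fixes f :: "'b::topological_space \<Rightarrow> 'a::complex_normed_vector"
  shows "continuous_on S f \<Longrightarrow> continuous_on S (\<lambda>x. c *\<^sub>C f x)"
  by (rule bounded_linear.continuous_on[OF bounded_linear_scaleC])

section \<open>Complex-linear operators and their values on total sets\<close>

lemma bounded_opsD: "T \<in> bounded_ops \<Longrightarrow> blinfun_apply T (c *\<^sub>C x) = c *\<^sub>C blinfun_apply T x"
  by (simp add: bounded_ops_def)

lemma blinfun_apply_scaleC [simp]: "blinfun_apply (c *\<^sub>C T) x = c *\<^sub>C blinfun_apply T x"
  by (simp add: scaleC_blinfun.rep_eq)

lemma id_in_bounded_ops [simp]: "id_blinfun \<in> bounded_ops"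
  by (simp add: bounded_ops_def)

lemma blinfun_compose_id [simp]: "T o\<^sub>L id_blinfun = T" "id_blinfun o\<^sub>L T = T"
  by (auto intro: blinfun_eqI)

lemma blinfun_compose_assoc: "(R o\<^sub>L S) o\<^sub>L T = R o\<^sub>L (S o\<^sub>L T)"
  by (auto intro: blinfun_eqI)

lemma blinfun_compose_in_bounded_ops:
  "S \<in> bounded_ops \<Longrightarrow> T \<in> bounded_ops \<Longrightarrow> S o\<^sub>L T \<in> bounded_ops"
  by (simp add: bounded_ops_def)

lemma zero_in_bounded_ops: "0 \<in> bounded_ops"
  and add_in_bounded_ops: "S \<in> bounded_ops \<Longrightarrow> T \<in> bounded_ops \<Longrightarrow> S + T \<in> bounded_ops"
  and diff_in_bounded_ops: "S \<in> bounded_ops \<Longrightarrow> T \<in> bounded_ops \<Longrightarrow> S - T \<in> bounded_ops"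
  and scaleC_in_bounded_ops: "T \<in> bounded_ops \<Longrightarrow> c *\<^sub>C T \<in> bounded_ops"
  by (auto simp: bounded_ops_def blinfun.add_left blinfun.diff_left scaleC_add_right
      scaleC_diff_right scaleC_scaleC mult.commute)

text \<open>
  A priori \<open>R\<close> and \<open>R'\<close> are only real-linear, as in the definite descriptions that define
  \<^const>\<open>tensor_op\<close> and \<^const>\<open>mult_unitary\<close>; hence the closure of \<open>S\<close> under complex multiples.
\<close>
lemma blinfun_eq_on_total:
  fixes R R' :: "'a::complex_normed_vector \<Rightarrow>\<^sub>L 'b::real_normed_vector"
  assumes "closure (cspan S) = UNIV" and "\<And>c s. s \<in> S \<Longrightarrow> c *\<^sub>C s \<in> S"
    and "\<And>s. s \<in> S \<Longrightarrow> blinfun_apply R s = blinfun_apply R' s"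
  shows "R = R'"
proof (rule blinfun_eqI)
  fix x
  have "x \<in> closure (cspan S)"
    by (simp add: assms(1))
  then have "\<forall>c. blinfun_apply R (c *\<^sub>C x) = blinfun_apply R' (c *\<^sub>C x)"
  proof (induction rule: closure_cspan_induct)
    case closed
    show ?case
      by (intro closed_Collect_all closed_Collect_eq continuous_intros)
  qed (simp_all add: assms(2,3) scaleC_add_right blinfun.add_right scaleC_scaleC)
  then show "blinfun_apply R x = blinfun_apply R' x"
    by (metis scaleC_one)
qed

text \<open>\<open>G\<close> is read as a piece of a graph. The bound on its span makes the closure
  of that span the graph of a function, and density together with completeness of the target makes
  this function total.\<close>

lemma blinfun_extension:
  fixes G :: "('a::complex_normed_vector \<times> 'b::chilbert_space) set"
  assumes bound: "\<And>u v. (u, v) \<in> cspan G \<Longrightarrow> norm v \<le> C * norm u"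
    and dense: "closure (cspan (fst ` G)) = UNIV"
  shows "\<exists>R\<in>bounded_ops. (\<forall>u v. (u, v) \<in> G \<longrightarrow> blinfun_apply R u = v) \<and>
    (\<forall>x. norm (blinfun_apply R x) \<le> C * norm x)"
proof -
  define H where "H = closure (cspan G)"
  \<comment> \<open>Hence the first components of \<open>cspan G\<close>, and not just their span,
    are dense.\<close>
  have dom: "cspan (fst ` G) \<subseteq> fst ` cspan G"
  proof
    fix u assume "u \<in> cspan (fst ` G)"
    then show "u \<in> fst ` cspan G"
    proof (induction rule: complex_vector.span_induct_alt)
      case base
      show ?case
        by (rule image_eqI[of _ _ 0]) (simp_all add: complex_vector.span_zero)
    next
      case (step c x y)
      then obtain p q where "p \<in> G" "x = fst p" "q \<in> cspan G" "y = fst q" by blast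
      then show ?case
        by (intro image_eqI[of _ _ "c *\<^sub>C p + q"] complex_vector.span_add[OF
            complex_vector.span_scale[OF complex_vector.span_base]]) (simp_all add: scaleC_prod_def)
    qed
  qed
  have Hbound: "norm v \<le> C * norm u" if "(u, v) \<in> H" for u v
  proof -
    have "closed {p::'a \<times> 'b. norm (snd p) \<le> C * norm (fst p)}"
      by (intro closed_Collect_le continuous_intros)
    then have "H \<subseteq> {p. norm (snd p) \<le> C * norm (fst p)}"
      unfolding H_def by (rule closure_minimal[rotated]) (use bound in force)
    then show ?thesis using that by auto
  qed
  have Hadd: "(u + u', v + v') \<in> H" if "(u, v) \<in> H" "(u', v') \<in> H" for u v u' v'
    using closure_cspan_add[OF that[unfolded H_def]] by (simp add: H_def)
  have Hscale: "(c *\<^sub>C u, c *\<^sub>C v) \<in> H" if uv: "(u, v) \<in> H" for u v c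
  proof -
    have "continuous_on UNIV (scaleC c :: 'a \<times> 'b \<Rightarrow> _)"
      unfolding scaleC_prod_def by (intro continuous_intros)
    from closure_cspan_scaleC_continuous[OF this uv[unfolded H_def]] show ?thesis
      by (simp add: scaleC_prod_def H_def)
  qed
  have Hdiff: "(u - u', v - v') \<in> H" if "(u, v) \<in> H" "(u', v') \<in> H" for u v u' v'
    using Hadd[OF that(1) Hscale[OF that(2), of "-1"]] by (simp add: scaleC_minus1)
  have ex: "\<exists>y. (x, y) \<in> H" for x
  proof -
    have "x \<in> closure (fst ` cspan G)"
      using closure_mono[OF dom] dense by auto
    then obtain u where u: "\<And>n. u n \<in> fst ` cspan G" "u \<longlonglongrightarrow> x"
      unfolding closure_sequential by blast
    then have "\<forall>n. \<exists>w. (u n, w) \<in> cspan G"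
      by force
    then obtain v where v: "\<And>n. (u n, v n) \<in> cspan G"
      by metis
    then have uvH: "(u n, v n) \<in> H" for n
      unfolding H_def using closure_subset by blast
    have "Cauchy v"
    proof (rule CauchyI)
      fix e :: real assume "e > 0"
      \<comment> \<open>Here \<open>C\<close> may be zero or negative, so a strictly positive
        Lipschitz constant is used.\<close>
      then have "e / (\<bar>C\<bar> + 1) > 0" by simp
      then obtain M where M: "\<And>m n. m \<ge> M \<Longrightarrow> n \<ge> M \<Longrightarrow> norm (u m - u n) < e / (\<bar>C\<bar> + 1)"
        using CauchyD[OF LIMSEQ_imp_Cauchy[OF u(2)]] by blast
      have "norm (v m - v n) < e" if "m \<ge> M" "n \<ge> M" for m n
      proof -
        have "norm (v m - v n) \<le> C * norm (u m - u n)"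
          by (rule Hbound[OF Hdiff[OF uvH uvH]])
        also have "\<dots> \<le> (\<bar>C\<bar> + 1) * norm (u m - u n)"
          by (intro mult_right_mono) auto
        also have "\<dots> < (\<bar>C\<bar> + 1) * (e / (\<bar>C\<bar> + 1))"
          by (rule mult_strict_left_mono[OF M[OF that]]) simp
        finally show ?thesis by simp
      qed
      then show "\<exists>M. \<forall>m\<ge>M. \<forall>n\<ge>M. norm (v m - v n) < e" by blast
    qed
    then obtain y where "v \<longlonglongrightarrow> y"
      using Cauchy_convergent convergent_def by blast
    then have "(\<lambda>n. (u n, v n)) \<longlonglongrightarrow> (x, y)"
      by (intro tendsto_Pair u(2))
    then show ?thesis
      unfolding H_def closure_sequential
      by (intro exI[of _ y] exI[of _ "\<lambda>n. (u n, v n)"] conjI) (simp_all add: v)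
  qed
  then obtain r where r: "\<And>x. (x, r x) \<in> H" by metis
  \<comment> \<open>The difference of the two pairs is \<open>(0, r x - y)\<close>, and the bound
    forces its second component to vanish.\<close>
  have r_eq: "r x = y" if "(x, y) \<in> H" for x y
    using Hbound[OF Hdiff[OF r[of x] that]] by simp
  have bl: "bounded_linear r"
  proof (rule bounded_linear_intro[where K = C])
    show "r (x + y) = r x + r y" for x y
      by (rule r_eq[OF Hadd[OF r r]])
    show "r (s *\<^sub>R x) = s *\<^sub>R r x" for s x
      using r_eq[OF Hscale[OF r]] by (metis scaleC_of_real)
    show "norm (r x) \<le> norm x * C" for x
      using Hbound[OF r] by (simp add: mult.commute)
  qed
  show ?thesis
  proof (intro bexI[of _ "Blinfun r"] conjI allI impI)
    show "Blinfun r \<in> bounded_ops"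
      using r_eq[OF Hscale[OF r]] by (simp add: bounded_ops_def bounded_linear_Blinfun_apply[OF bl])
    show "blinfun_apply (Blinfun r) u = v" if "(u, v) \<in> G" for u v
    proof -
      have "(u, v) \<in> H"
        unfolding H_def using complex_vector.span_base[OF that] closure_subset by blast
      then show ?thesis
        by (simp add: bounded_linear_Blinfun_apply[OF bl] r_eq)
    qed
    show "norm (blinfun_apply (Blinfun r) x) \<le> C * norm x" for x
      using Hbound[OF r] by (simp add: bounded_linear_Blinfun_apply[OF bl])
  qed
qed


section \<open>The complex inner product\<close>

lemma cinner_add_left: "cinner (x + y) z = cinner x z + cinner y z"
  and cinner_zero_left [simp]: "cinner 0 z = 0"
  and cinner_zero_right [simp]: "cinner z 0 = 0"
  and cinner_diff_left: "cinner (x - y) z = cinner x z - cinner y z"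
  and cinner_diff_right: "cinner z (x - y) = cinner z x - cinner z y"
  for x :: "'a::chilbert_space"
proof -
  have a: "cinner (x + y) z = cinner x z + cinner y z" for x y z :: 'a
    by (metis cinner_add_right cinner_commute complex_cnj_add)
  have m: "cinner (- x) z = - cinner x z" "cinner z (- x) = - cinner z x" for x z :: 'a
    using cinner_scaleC_left[of "-1" x z] cinner_scaleC_right[of z "-1" x]
    by (simp_all add: scaleC_minus1)
  have z: "cinner 0 z = 0" "cinner z 0 = 0" for z :: 'a
    using cinner_scaleC_left[of 0 0 z] cinner_scaleC_right[of z 0 0] by simp_all
  show "cinner (x + y) z = cinner x z + cinner y z" "cinner 0 z = 0" "cinner z 0 = 0"
    "cinner (x - y) z = cinner x z - cinner y z" "cinner z (x - y) = cinner z x - cinner z y"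
    using a[of x "- y" z] cinner_add_right[of z x "- y"] by (simp_all add: a m z)
qed

lemma cinner_sum_left: "cinner (\<Sum>i\<in>I. f i) z = (\<Sum>i\<in>I. cinner (f i) z)"
  and cinner_sum_right: "cinner z (\<Sum>i\<in>I. f i) = (\<Sum>i\<in>I. cinner z (f i))"
  for z :: "'a::chilbert_space"
  by (induction I rule: infinite_finite_induct) (simp_all add: cinner_add_left cinner_add_right)

text \<open>Rotating the first argument by \<open>\<i>\<close> turns the imaginary part into a real
  part. This is how identities for the real inner product are lifted to the complex one.\<close>

lemma cinner_eq_inner: "cinner x y = Complex (inner x y) (inner (\<i> *\<^sub>C x) y)"
  for x y :: "'a::chilbert_space"
  using Re_cinner[of x y] Re_cinner[of "\<i> *\<^sub>C x" y]
  by (simp add: complex_eq_iff cinner_scaleC_left)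

lemma norm_cinner_le: "cmod (cinner x y) \<le> norm x * norm y" for x y :: "'a::chilbert_space"
proof (cases "cinner x y = 0")
  case False
  \<comment> \<open>The phase that rotates \<open>cinner x y\<close> onto the positive real axis,
    where the real Cauchy-Schwarz inequality applies.\<close>
  define c where "c = cnj (cinner x y) / cmod (cinner x y)"
  have "cmod c = 1" using False by (simp add: c_def norm_divide)
  have "cinner x (c *\<^sub>C y) = cnj (cinner x y) * cinner x y / cmod (cinner x y)"
    by (simp add: cinner_scaleC_right c_def)
  also have "\<dots> = complex_of_real ((cmod (cinner x y))\<^sup>2) / cmod (cinner x y)"
    by (simp only: mult.commute[of "cnj (cinner x y)"] complex_norm_square[symmetric]
        of_real_divide)
  also have "\<dots> = of_real (cmod (cinner x y))"
    using False by (simp add: power2_eq_square)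
  finally have "cmod (cinner x y) = inner x (c *\<^sub>C y)"
    by (metis Re_cinner Re_complex_of_real)
  also have "\<dots> \<le> norm x * norm (c *\<^sub>C y)"
    by (rule norm_cauchy_schwarz)
  finally show ?thesis
    by (simp add: norm_scaleC \<open>cmod c = 1\<close>)
qed simp

lemma bounded_linear_cinner_right: "bounded_linear (cinner x)" for x :: "'a::chilbert_space"
proof (rule bounded_linear_intro[where K = "norm x"])
  show "cinner x (r *\<^sub>R y) = r *\<^sub>R cinner x y" for r y
    by (simp flip: scaleC_of_real add: cinner_scaleC_right scaleR_conv_of_real)
qed (simp_all add: cinner_add_right norm_cinner_le mult.commute[of _ "norm x"])

lemma bounded_linear_cinner_left: "bounded_linear (\<lambda>x. cinner x y)" for y :: "'a::chilbert_space"
proof (rule bounded_linear_intro[where K = "norm y"])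
  show "cinner (r *\<^sub>R x) y = r *\<^sub>R cinner x y" for r x
    by (simp flip: scaleC_of_real add: cinner_scaleC_left scaleR_conv_of_real)
qed (simp_all add: cinner_add_left norm_cinner_le)

lemmas continuous_on_cinner_right [continuous_intros] =
  bounded_linear.continuous_on[OF bounded_linear_cinner_right]
lemmas continuous_on_cinner_left [continuous_intros] =
  bounded_linear.continuous_on[OF bounded_linear_cinner_left]

lemma cinner_ext_dense:
  fixes x y :: "'a::chilbert_space"
  assumes "closure S = UNIV" and "\<And>s. s \<in> S \<Longrightarrow> cinner s x = cinner s y"
  shows "x = y"
proof -
  have "closed {s. cinner s x = cinner s y}"
    by (intro closed_Collect_eq continuous_intros)
  then have "closure S \<subseteq> {s. cinner s x = cinner s y}"
    using assms(2) by (intro closure_minimal) auto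
  then have "cinner (x - y) (x - y) = 0"
    using assms(1) by (auto simp: cinner_diff_right)
  then show ?thesis
    by (simp add: cinner_self)
qed

lemma cinner_ext: "(\<And>s. cinner s x = cinner s y) \<Longrightarrow> x = y" for x y :: "'a::chilbert_space"
  by (rule cinner_ext_dense[of UNIV]) simp_all

text \<open>
  The representing vector minimises \<open>\<parallel>x\<parallel>\<^sup>2 / 2 - f x\<close>; by the parallelogram law, minimising
  sequences are Cauchy.
\<close>
lemma riesz_representation:
  fixes f :: "'a::{real_inner, complete_space} \<Rightarrow> real"
  assumes f: "bounded_linear f"
  obtains z where "\<And>x. f x = inner z x"
proof -
  interpret f: bounded_linear f by (rule f)
  define g where "g x = (norm x)\<^sup>2 / 2 - f x" for x
  obtain K where K: "\<And>x. norm (f x) \<le> norm x * K"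
    using f.bounded by blast
  have lower: "- K\<^sup>2 / 2 \<le> g x" for x
  proof -
    have "0 \<le> (norm x - K)\<^sup>2" by simp
    then have "norm x * K \<le> ((norm x)\<^sup>2 + K\<^sup>2) / 2"
      by (simp add: power2_diff field_simps)
    then show ?thesis
      using K[of x] by (simp add: g_def)
  qed
  define m where "m = (INF x. g x)"
  have m_le: "m \<le> g x" for x
    unfolding m_def by (rule cINF_lower) (use lower in \<open>auto intro!: bdd_belowI\<close>)
  have "\<exists>x. g x < m + inverse (Suc n)" for n
    using cInf_lessD[of "range g" "m + inverse (Suc n)"] by (auto simp: m_def)
  then obtain u where u: "\<And>n. g (u n) < m + inverse (Suc n)" by metis
  have parallelogram: "(norm (x - y))\<^sup>2 \<le> 4 * (g x - m + (g y - m))" for x y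
  proof -
    \<comment> \<open>The midpoint of \<open>x\<close> and \<open>y\<close> is a competitor for the
      infimum \<open>m\<close>; the linear part of \<open>g\<close> cancels and the parallelogram
      law gives the rest.\<close>
    have "g ((1/2) *\<^sub>R (x + y)) = (g x + g y) / 2 - (norm (x - y))\<^sup>2 / 8"
      unfolding g_def power2_norm_eq_inner f.scaleR f.add
      by (simp add: algebra_simps inner_commute) (simp add: field_simps)
    then show ?thesis using m_le[of "(1/2) *\<^sub>R (x + y)"] by (simp add: field_simps)
  qed
  have "Cauchy u"
  proof (rule CauchyI)
    fix e :: real assume "e > 0"
    then obtain M where M: "inverse (real (Suc M)) < e\<^sup>2 / 8"
      using reals_Archimedean[of "e\<^sup>2 / 8"] by auto
    have "norm (u i - u j) < e" if "i \<ge> M" "j \<ge> M" for i j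
    proof -
      have "g (u k) - m < e\<^sup>2 / 8" if "k \<ge> M" for k
      proof -
        have "g (u k) - m < inverse (real (Suc k))"
          using u[of k] by (simp only: algebra_simps)
        also have "\<dots> \<le> inverse (real (Suc M))"
          using that by (simp add: le_imp_inverse_le)
        finally show ?thesis using M by (rule less_trans)
      qed
      from this[OF that(1)] this[OF that(2)] have "(norm (u i - u j))\<^sup>2 < e\<^sup>2"
        using parallelogram[of "u i" "u j"] by simp
      then show ?thesis
        using \<open>e > 0\<close> power2_less_imp_less by fastforce
    qed
    then show "\<exists>M. \<forall>m\<ge>M. \<forall>n\<ge>M. norm (u m - u n) < e" by blast
  qed
  then obtain z where z: "u \<longlonglongrightarrow> z"
    using Cauchy_convergent convergent_def by blast
  then have "(\<lambda>n. g (u n)) \<longlonglongrightarrow> g z"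
    unfolding g_def by (intro tendsto_intros f.tendsto) simp_all
  moreover have "(\<lambda>n. m + inverse (real (Suc n))) \<longlonglongrightarrow> m + 0"
    by (intro tendsto_intros LIMSEQ_inverse_real_of_nat)
  ultimately have "g z \<le> m + 0"
    by (rule LIMSEQ_le) (use u less_imp_le in blast)
  then have min: "g z \<le> g x" for x
    using m_le[of x] by simp
  have "f x = inner z x" for x
  proof (rule ccontr)
    define d where "d = inner z x - f x"
    assume "f x \<noteq> inner z x"
    then have "d \<noteq> 0" by (simp add: d_def)
    define N where "N = (norm x)\<^sup>2 + 1"
    \<comment> \<open>This \<open>s\<close> minimises the upper bound
      \<open>s * d + s^2 * N / 2\<close>, whose minimum is \<open>- d^2 / (2 * N)\<close>. The
      summand 1 in \<open>N\<close> allows division also when \<open>x = 0\<close>.\<close>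
    define s where "s = - d / N"
    have pos: "N > 0" unfolding N_def by (rule add_nonneg_pos) simp_all
    have "g (z + s *\<^sub>R x) = g z + s * d + s\<^sup>2 * (norm x)\<^sup>2 / 2"
      unfolding g_def d_def power2_norm_eq_inner f.scaleR f.add
      by (simp add: algebra_simps inner_commute power2_eq_square add_divide_distrib)
    then have "0 \<le> s * d + s\<^sup>2 * (norm x)\<^sup>2 / 2"
      using min[of "z + s *\<^sub>R x"] by simp
    also have "\<dots> \<le> s * d + s\<^sup>2 * N / 2"
      by (simp add: mult_left_mono N_def)
    also have "\<dots> = - (d\<^sup>2 / N) / 2"
      using pos by (simp add: s_def field_simps power2_eq_square)
    also have "\<dots> < 0"
      using \<open>d \<noteq> 0\<close> pos by simp
    finally show False by simp
  qed
  then show thesis by (rule that)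
qed

section \<open>Adjoints of complex-linear operators\<close>

lemma adjoint_exists:
  fixes T :: "'a::chilbert_space \<Rightarrow>\<^sub>L 'b::chilbert_space"
  assumes T: "T \<in> bounded_ops"
  obtains S where "\<And>x y. cinner (blinfun_apply T x) y = cinner x (blinfun_apply S y)"
proof -
  \<comment> \<open>The real Riesz theorem yields a real adjoint pointwise; uniqueness of the
    representing vector then makes it linear.\<close>
  have "\<exists>z. \<forall>x. inner (blinfun_apply T x) y = inner x z" for y
  proof -
    have "bounded_linear (\<lambda>x. inner (blinfun_apply T x) y)"
      by (intro bounded_linear_compose[OF bounded_linear_inner_left] blinfun.bounded_linear_right)
    from riesz_representation[OF this] obtain z where "\<And>x. inner (blinfun_apply T x) y = inner z x"
      by blast
    then show ?thesis by (auto simp: inner_commute)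
  qed
  then obtain s where s: "\<And>x y. inner (blinfun_apply T x) y = inner x (s y)" by metis
  have s_eq: "s y = z" if "\<And>x. inner (blinfun_apply T x) y = inner x z" for y z
    using that by (metis inner_commute s vector_eq_ldot)
  have bl: "bounded_linear s"
  proof (rule bounded_linear_intro[where K = "norm T"])
    show "s (x + y) = s x + s y" for x y
      by (rule s_eq) (simp add: inner_add_right s)
    show "s (r *\<^sub>R x) = r *\<^sub>R s x" for r x
      by (rule s_eq) (simp add: s)
    show "norm (s y) \<le> norm y * norm T" for y
    proof (cases "s y = 0")
      case False
      have "norm (s y) * norm (s y) = inner (blinfun_apply T (s y)) y"
        by (simp add: s power2_norm_eq_inner flip: power2_eq_square)
      also have "\<dots> \<le> norm (blinfun_apply T (s y)) * norm y"
        by (rule norm_cauchy_schwarz)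
      also have "\<dots> \<le> norm T * norm (s y) * norm y"
        by (rule mult_right_mono[OF norm_blinfun]) simp
      finally show ?thesis using False by (simp add: algebra_simps)
    qed simp
  qed
  show thesis
  proof
    \<comment> \<open>The imaginary part of the identity is the real identity at
      \<open>\<i> *\<^sub>C x\<close>, because \<open>T\<close> commutes with multiplication by
      \<open>\<i>\<close>.\<close>
    show "cinner (blinfun_apply T x) y = cinner x (blinfun_apply (Blinfun s) y)" for x y
      unfolding cinner_eq_inner bounded_opsD[OF T, symmetric]
      by (simp add: bounded_linear_Blinfun_apply[OF bl] s)
  qed
qed

lemma adj_eqI:
  assumes "\<And>x y. cinner (blinfun_apply T x) y = cinner x (blinfun_apply S y)"
  shows "adj T = S"
  unfolding adj_def
proof (rule the_equality)
  fix S' assume "\<forall>x y. cinner (blinfun_apply T x) y = cinner x (blinfun_apply S' y)"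
  then show "S' = S"
    by (intro blinfun_eqI cinner_ext) (metis assms)
qed (use assms in blast)

lemma cinner_adj_right:
  assumes "T \<in> bounded_ops"
  shows "cinner x (blinfun_apply (adj T) y) = cinner (blinfun_apply T x) y"
  using adjoint_exists[OF assms] adj_eqI by metis

lemma cinner_adj_left:
  assumes "T \<in> bounded_ops"
  shows "cinner (blinfun_apply (adj T) y) x = cinner y (blinfun_apply T x)"
  by (metis cinner_adj_right[OF assms] cinner_commute)

lemma adj_in_bounded_ops: "T \<in> bounded_ops \<Longrightarrow> adj T \<in> bounded_ops"
  unfolding bounded_ops_def mem_Collect_eq
  by (intro allI cinner_ext) (simp add: cinner_adj_right cinner_scaleC_right bounded_ops_def)

lemma adj_adj: "T \<in> bounded_ops \<Longrightarrow> adj (adj T) = T"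
  by (rule adj_eqI) (rule cinner_adj_left)

lemma adj_id [simp]: "adj id_blinfun = id_blinfun"
  by (rule adj_eqI) simp

lemma adj_diff: "S \<in> bounded_ops \<Longrightarrow> T \<in> bounded_ops \<Longrightarrow> adj (S - T) = adj S - adj T"
  by (rule adj_eqI) (simp add: blinfun.diff_left cinner_diff_left cinner_diff_right cinner_adj_right)

lemma adj_compose:
  "S \<in> bounded_ops \<Longrightarrow> T \<in> bounded_ops \<Longrightarrow> adj (S o\<^sub>L T) = adj T o\<^sub>L adj S"
  by (rule adj_eqI) (simp add: cinner_adj_right)

lemma norm_adj_le:
  assumes T: "T \<in> bounded_ops"
  shows "norm (adj T) \<le> norm T"
proof (rule norm_blinfun_bound)
  fix y
  show "norm (blinfun_apply (adj T) y) \<le> norm T * norm y" (is "norm ?z \<le> _")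
  proof (cases "?z = 0")
    case False
    have "norm ?z * norm ?z = inner (blinfun_apply T ?z) y"
      using cinner_adj_right[OF T, of ?z y]
      by (metis Re_cinner power2_norm_eq_inner power2_eq_square)
    also have "\<dots> \<le> norm (blinfun_apply T ?z) * norm y"
      by (rule norm_cauchy_schwarz)
    also have "\<dots> \<le> norm T * norm ?z * norm y"
      by (rule mult_right_mono[OF norm_blinfun]) simp
    finally show ?thesis using False by (simp add: algebra_simps)
  qed simp
qed simp


section \<open>Tensor products of operators\<close>

context hilbert_tensor
begin

section \<open>Elementary tensors and the interchange of legs\<close>

lemma norm_tensor: "norm (t x y) = norm x * norm y"
proof -
  have "complex_of_real ((norm (t x y))\<^sup>2) = of_real ((norm x * norm y)\<^sup>2)"
    by (simp only: cinner_self[symmetric] cinner_tensor) (simp add: cinner_self power_mult_distrib)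
  then show ?thesis
    by (simp only: of_real_eq_iff power2_eq_iff_nonneg norm_ge_zero mult_nonneg_nonneg)
qed

lemma bounded_linear_left: "bounded_linear (\<lambda>x. t x y)"
  by (rule bounded_linear_intro[where K = "norm y"])
    (simp_all add: add_left scaleC_left norm_tensor flip: scaleC_of_real)

lemma bounded_linear_right: "bounded_linear (t x)"
  by (rule bounded_linear_intro[where K = "norm x"])
    (simp_all add: add_right scaleC_right norm_tensor mult.commute flip: scaleC_of_real)

text \<open>Lets every statement about one tensor leg be reused for the other by instantiating the
  locale at the flipped map.\<close>

lemma flip: "hilbert_tensor (\<lambda>x y. t y x)"
proof
  have "{t y x | x y. True} = {t x y | x y. True}" by blast
  then show "closure (cspan {t y x | x y. True}) = UNIV"
    by (simp only: dense)
qed (simp_all add: add_left add_right scaleC_left scaleC_right cinner_tensor)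

lemma scaleC_simple_tensor:
  "s \<in> {t x y | x y. True} \<Longrightarrow> c *\<^sub>C s \<in> {t x y | x y. True}"
  using scaleC_left[symmetric] by blast

lemma blinfun_eq_on_tensors:
  fixes R R' :: "'c \<Rightarrow>\<^sub>L 'd::real_normed_vector"
  assumes "\<And>x y. blinfun_apply R (t x y) = blinfun_apply R' (t x y)"
  shows "R = R'"
  by (rule blinfun_eq_on_total[OF dense scaleC_simple_tensor]) (use assms in auto)

lemma cinner_ext_tensors:
  assumes "\<And>x y. cinner (t x y) u = cinner (t x y) v"
  shows "u = v"
proof (rule cinner_ext_dense[OF dense])
  fix s assume "s \<in> cspan {t x y | x y. True}"
  then show "cinner s u = cinner s v"
    by (induction rule: complex_vector.span_induct_alt)
      (auto simp: cinner_add_left cinner_scaleC_left assms)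
qed

text \<open>Gram-Schmidt on the second leg, adding one elementary tensor at a time. The pair carries
  a vector and its image under \<open>S\<close> on the first leg along together, so both are written
  with the same orthonormal set and their norms become comparable termwise.\<close>

lemma orthonormal_representation:
  assumes S: "S \<in> bounded_ops"
    and "p \<in> cspan {(t x y, t (blinfun_apply S x) y) | x y. True}"
  shows "\<exists>E f. finite E \<and> (\<forall>e\<in>E. \<forall>e'\<in>E. cinner e e' = (if e = e' then 1 else 0)) \<and>
    p = (\<Sum>e\<in>E. t (f e) e, \<Sum>e\<in>E. t (blinfun_apply S (f e)) e)"
  using assms(2)
proof (induction rule: complex_vector.span_induct_alt)
  case base
  show ?case
    by (rule exI[of _ "{}"]) (simp add: zero_prod_def)
next
  case (step c p q)
  then obtain x y E f where p: "p = (t x y, t (blinfun_apply S x) y)" and "finite E"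
    and on: "\<And>e e'. e \<in> E \<Longrightarrow> e' \<in> E \<Longrightarrow> cinner e e' = (if e = e' then 1 else 0)"
    and q: "q = (\<Sum>e\<in>E. t (f e) e, \<Sum>e\<in>E. t (blinfun_apply S (f e)) e)"
    by blast
  \<comment> \<open>The scalar is absorbed into the first factor. The part of \<open>y\<close> in
    the span of \<open>E\<close> only changes the coefficients, from \<open>f\<close> to
    \<open>g\<close>; the orthogonal remainder \<open>w\<close> needs a new basis vector unless it
    vanishes.\<close>
  define z where "z = c *\<^sub>C x"
  define w where "w = y - (\<Sum>e\<in>E. cinner e y *\<^sub>C e)"
  define g where "g e = f e + cinner e y *\<^sub>C z" for e
  have w_orth: "cinner e w = 0" if "e \<in> E" for e
  proof -
    have "(\<Sum>e'\<in>E. cinner e' y * cinner e e') = (\<Sum>e'\<in>E. if e' = e then cinner e' y else 0)"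
      by (rule sum.cong) (use on that in auto)
    also have "\<dots> = cinner e y"
      using \<open>finite E\<close> that by simp
    finally show ?thesis
      by (simp add: w_def cinner_diff_right cinner_sum_right cinner_scaleC_right)
  qed
  have add_y: "t u y = t u w + (\<Sum>e\<in>E. t (cinner e y *\<^sub>C u) e)" for u
  proof -
    have "t u y = t u (w + (\<Sum>e\<in>E. cinner e y *\<^sub>C e))"
      by (simp add: w_def)
    also have "\<dots> = t u w + (\<Sum>e\<in>E. t u (cinner e y *\<^sub>C e))"
      by (simp add: add_right linear_sum[OF bounded_linear.linear[OF bounded_linear_right]])
    finally show ?thesis
      by (simp add: scaleC_left scaleC_right)
  qed
  have Sg: "blinfun_apply S (g e) = blinfun_apply S (f e) + cinner e y *\<^sub>C blinfun_apply S z" for e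
    by (simp add: g_def blinfun.add_right bounded_opsD[OF S])
  have pq: "c *\<^sub>C p + q =
      (t z w + (\<Sum>e\<in>E. t (g e) e), t (blinfun_apply S z) w + (\<Sum>e\<in>E. t (blinfun_apply S (g e)) e))"
    by (simp add: p q scaleC_prod_def flip: scaleC_left bounded_opsD[OF S] z_def)
      (simp add: add_y[of z] add_y[of "blinfun_apply S z"] Sg add_left sum.distrib,
       simp add: g_def add_left sum.distrib)
  show ?case
  proof (cases "w = 0")
    case True
    have "t u 0 = 0" for u
      using scaleC_right[of u 0 0] by simp
    then show ?thesis
      using pq True \<open>finite E\<close> on by (intro exI[of _ E] exI[of _ g]) simp
  next
    case False
    \<comment> \<open>The remainder is normalised, and its norm moves to the coefficient of the new
      vector.\<close>
    define e0 where "e0 = of_real (1 / norm w) *\<^sub>C w"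
    define g' where "g' = g(e0 := of_real (norm w) *\<^sub>C z)"
    have e0_orth: "cinner e e0 = 0" "cinner e0 e = 0" if "e \<in> E" for e
      using w_orth[OF that] cinner_commute[of w e]
      by (simp_all add: e0_def cinner_scaleC_left cinner_scaleC_right)
    have e0_unit: "cinner e0 e0 = 1"
      using False by (simp add: e0_def cinner_self norm_scaleC norm_divide)
    have "e0 \<notin> E"
      using e0_orth e0_unit by fastforce
    have w: "w = of_real (norm w) *\<^sub>C e0"
      using False by (simp add: e0_def scaleC_scaleC)
    have t_w: "t u w = t (of_real (norm w) *\<^sub>C u) e0" for u
      by (subst w) (simp add: scaleC_left scaleC_right)
    have "g' e = g e" if "e \<in> E" for e
      using that \<open>e0 \<notin> E\<close> by (auto simp: g'_def)
    then have "c *\<^sub>C p + q = (\<Sum>e\<in>insert e0 E. t (g' e) e,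
        \<Sum>e\<in>insert e0 E. t (blinfun_apply S (g' e)) e)"
      using \<open>finite E\<close> \<open>e0 \<notin> E\<close>
      by (simp add: pq t_w) (simp add: g'_def bounded_opsD[OF S])
    then show ?thesis
      using \<open>finite E\<close> \<open>e0 \<notin> E\<close> on e0_orth e0_unit
      by (intro exI[of _ "insert e0 E"] exI[of _ g']) auto
  qed
qed

lemma norm_orthonormal_sum:
  assumes "finite E" "\<And>e e'. e \<in> E \<Longrightarrow> e' \<in> E \<Longrightarrow> cinner e e' = (if e = e' then 1 else 0)"
  shows "(norm (\<Sum>e\<in>E. t (f e) e))\<^sup>2 = (\<Sum>e\<in>E. (norm (f e))\<^sup>2)"
proof -
  have "complex_of_real ((norm (\<Sum>e\<in>E. t (f e) e))\<^sup>2) =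
      (\<Sum>e\<in>E. \<Sum>e'\<in>E. cinner (f e) (f e') * cinner e e')"
    by (simp only: cinner_self[symmetric] cinner_sum_left cinner_sum_right cinner_tensor)
      (rule sum.swap)
  also have "\<dots> = (\<Sum>e\<in>E. \<Sum>e'\<in>E. if e' = e then cinner (f e) (f e') else 0)"
    by (intro sum.cong refl) (use assms(2) in auto)
  also have "\<dots> = (\<Sum>e\<in>E. of_real ((norm (f e))\<^sup>2))"
    using assms(1) by (simp add: cinner_self)
  finally show ?thesis
    by (simp only: of_real_sum[symmetric] of_real_eq_iff)
qed

lemma tensor_id_exists:
  assumes S: "S \<in> bounded_ops"
  shows "\<exists>R\<in>bounded_ops. \<forall>x y. blinfun_apply R (t x y) = t (blinfun_apply S x) y"
proof -
  let ?G = "{(t x y, t (blinfun_apply S x) y) | x y. True}"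
  \<comment> \<open>By orthonormality both squared norms are sums of squared coefficient norms, and
    each summand grows by at most the factor \<open>(norm S)^2\<close>.\<close>
  have bound: "norm v \<le> norm S * norm u" if uv: "(u, v) \<in> cspan ?G" for u v
  proof -
    obtain E f where E: "finite E"
        "\<And>e e'. e \<in> E \<Longrightarrow> e' \<in> E \<Longrightarrow> cinner e e' = (if e = e' then 1 else 0)"
      and u: "u = (\<Sum>e\<in>E. t (f e) e)" and v: "v = (\<Sum>e\<in>E. t (blinfun_apply S (f e)) e)"
      using orthonormal_representation[OF S uv] by auto
    have "(norm v)\<^sup>2 = (\<Sum>e\<in>E. (norm (blinfun_apply S (f e)))\<^sup>2)"
      unfolding v by (rule norm_orthonormal_sum[OF E])
    also have "\<dots> \<le> (\<Sum>e\<in>E. (norm S * norm (f e))\<^sup>2)"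
      by (intro sum_mono power_mono norm_blinfun) simp
    also have "\<dots> = (norm S * norm u)\<^sup>2"
      by (simp add: u power_mult_distrib norm_orthonormal_sum[OF E] sum_distrib_left)
    finally show ?thesis
      by (rule power2_le_imp_le) simp
  qed
  have "fst ` ?G = {t x y | x y. True}"
    by (force simp: image_iff)
  then have total: "closure (cspan (fst ` ?G)) = UNIV"
    by (simp only: dense)
  obtain R where R: "R \<in> bounded_ops" "\<forall>u v. (u, v) \<in> ?G \<longrightarrow> blinfun_apply R u = v"
    using blinfun_extension[OF bound total] by blast
  have "blinfun_apply R (t x y) = t (blinfun_apply S x) y" for x y
    by (rule R(2)[rule_format]) blast
  with R(1) show ?thesis by blast
qed

lemma tensor_op_exists:
  assumes S: "S \<in> bounded_ops" and T: "T \<in> bounded_ops"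
  shows "tensor_op t S T \<in> bounded_ops \<and>
    (\<forall>x y. blinfun_apply (tensor_op t S T) (t x y) = t (blinfun_apply S x) (blinfun_apply T y))"
proof -
  obtain R where R: "R \<in> bounded_ops" "\<forall>x y. blinfun_apply R (t x y) = t (blinfun_apply S x) y"
    using tensor_id_exists[OF S] by blast
  \<comment> \<open>The operator on the second leg comes from the flipped tensor product; the full
    tensor product operator is the composite of the two.\<close>
  obtain R' where R': "R' \<in> bounded_ops" "\<forall>x y. blinfun_apply R' (t x y) = t x (blinfun_apply T y)"
    using hilbert_tensor.tensor_id_exists[OF flip T] by blast
  have "tensor_op t S T = R o\<^sub>L R'"
    unfolding tensor_op_def
  proof (rule the_equality)
    fix Q assume "\<forall>x y. blinfun_apply Q (t x y) = t (blinfun_apply S x) (blinfun_apply T y)"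
    then show "Q = R o\<^sub>L R'"
      by (intro blinfun_eq_on_tensors) (simp add: R R')
  qed (simp add: R R')
  then show ?thesis
    by (simp add: R R' blinfun_compose_in_bounded_ops)
qed

lemmas tensor_op_in_bounded_ops = tensor_op_exists[THEN conjunct1]
lemmas tensor_op_apply = tensor_op_exists[THEN conjunct2, rule_format]

lemma tensor_op_flip: "tensor_op (\<lambda>x y. t y x) S T = tensor_op t T S"
  unfolding tensor_op_def by (rule arg_cong[of _ _ The]) (rule ext, blast)

lemma min_tensor_flip: "min_tensor (\<lambda>x y. t y x) B A = min_tensor t A B"
proof -
  have "{tensor_op t a b | b a. b \<in> B \<and> a \<in> A} = {tensor_op t a b | a b. a \<in> A \<and> b \<in> B}"
    by blast
  then show ?thesis
    by (simp add: min_tensor_def tensor_op_flip)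
qed

section \<open>Products, differences, adjoints and slices of tensor operators\<close>

lemma tensor_op_compose:
  assumes "S \<in> bounded_ops" "T \<in> bounded_ops" "S' \<in> bounded_ops" "T' \<in> bounded_ops"
  shows "tensor_op t S T o\<^sub>L tensor_op t S' T' = tensor_op t (S o\<^sub>L S') (T o\<^sub>L T')"
  by (rule blinfun_eq_on_tensors)
    (simp add: assms tensor_op_apply blinfun_compose_in_bounded_ops)

lemma tensor_op_diff_right:
  assumes "S \<in> bounded_ops" "T \<in> bounded_ops" "T' \<in> bounded_ops"
  shows "tensor_op t S (T - T') = tensor_op t S T - tensor_op t S T'"
  by (rule blinfun_eq_on_tensors)
    (simp add: assms tensor_op_apply diff_in_bounded_ops blinfun.diff_left
      linear_diff[OF bounded_linear.linear[OF bounded_linear_right]])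

lemma adj_tensor_op:
  assumes S: "S \<in> bounded_ops" and T: "T \<in> bounded_ops"
  shows "adj (tensor_op t S T) = tensor_op t (adj S) (adj T)"
proof (rule blinfun_eq_on_tensors, rule cinner_ext_tensors)
  show "cinner (t x y) (blinfun_apply (adj (tensor_op t S T)) (t x' y')) =
      cinner (t x y) (blinfun_apply (tensor_op t (adj S) (adj T)) (t x' y'))" for x y x' y'
    by (simp add: S T cinner_adj_right tensor_op_in_bounded_ops tensor_op_apply
        adj_in_bounded_ops cinner_tensor)
qed

lemma slice_right_spec:
  assumes X: "X \<in> bounded_ops"
  shows "cinner x (blinfun_apply (slice_right t \<xi> X) y) =
    cinner (t x \<xi>) (blinfun_apply X (t y \<xi>))"
proof -
  \<comment> \<open>Tensoring with \<open>\<xi>\<close> is a bounded operator \<open>L\<close>, and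
    the slice of \<open>X\<close> is the compression \<open>L* X L\<close>.\<close>
  define L where "L = Blinfun (\<lambda>x. t x \<xi>)"
  have L: "blinfun_apply L x = t x \<xi>" for x
    by (simp add: L_def bounded_linear_Blinfun_apply[OF bounded_linear_left])
  then have "L \<in> bounded_ops"
    by (simp add: bounded_ops_def scaleC_left)
  define T where "T = adj L o\<^sub>L X o\<^sub>L L"
  have T: "cinner x (blinfun_apply T y) = cinner (t x \<xi>) (blinfun_apply X (t y \<xi>))" for x y
    by (simp add: T_def cinner_adj_right[OF \<open>L \<in> bounded_ops\<close>] L)
  have "slice_right t \<xi> X = T"
    unfolding slice_right_def
  proof (rule the_equality)
    fix Q assume "\<forall>x y. cinner x (blinfun_apply Q y) = cinner (t x \<xi>) (blinfun_apply X (t y \<xi>))"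
    then show "Q = T"
      by (intro blinfun_eqI cinner_ext) (simp add: T)
  qed (simp add: T)
  then show ?thesis
    by (simp add: T)
qed

lemma slice_flip: "slice_right (\<lambda>x y. t y x) \<xi> X = slice_left t \<xi> X"
  "slice_left (\<lambda>x y. t y x) \<eta> X = slice_right t \<eta> X"
  by (simp_all add: slice_left_def slice_right_def)

end

lemma (in hilbert_tensor) slice_left_spec:
  assumes X: "X \<in> bounded_ops"
  shows "cinner x (blinfun_apply (slice_left t \<xi> X) y) =
    cinner (t \<xi> x) (blinfun_apply X (t \<xi> y))"
  using hilbert_tensor.slice_right_spec[OF flip X] by (simp add: slice_flip)


section \<open>The conditional expectation onto the image of the coproduct\<close>

instance chilbert_space \<subseteq> banach ..

section \<open>Commutants, limits of adjoints and the minimal tensor product\<close>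

lemma adj_in_commutant:
  assumes X: "X \<subseteq> bounded_ops" "\<And>S. S \<in> X \<Longrightarrow> adj S \<in> X" and T: "T \<in> commutant X"
  shows "adj T \<in> commutant X"
proof -
  have T': "T \<in> bounded_ops" "\<And>S. S \<in> X \<Longrightarrow> T o\<^sub>L S = S o\<^sub>L T"
    using T by (auto simp: commutant_def)
  have "adj T o\<^sub>L S = S o\<^sub>L adj T" if "S \<in> X" for S
  proof -
    have "adj (adj S o\<^sub>L T) = adj (T o\<^sub>L adj S)"
      using T'(2)[OF X(2)[OF that]] by simp
    then show ?thesis
      using X that T'(1) by (simp add: adj_compose adj_adj adj_in_bounded_ops subset_iff)
  qed
  then show ?thesis
    by (simp add: commutant_def T'(1) adj_in_bounded_ops)
qed

lemma tendsto_adj: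
  fixes f :: "nat \<Rightarrow> ('a::chilbert_space \<Rightarrow>\<^sub>L 'b::chilbert_space)"
  assumes f: "\<And>n. f n \<in> bounded_ops" and l: "l \<in> bounded_ops" and lim: "f \<longlonglongrightarrow> l"
  shows "(\<lambda>n. adj (f n)) \<longlonglongrightarrow> adj l"
proof (rule metric_tendsto_imp_tendsto[OF lim])
  show "\<forall>\<^sub>F n in sequentially. dist (adj (f n)) (adj l) \<le> dist (f n) l"
    using f l by (auto simp: dist_norm norm_adj_le diff_in_bounded_ops simp flip: adj_diff)
qed

lemma closed_bounded_ops: "closed (bounded_ops :: ('a::chilbert_space \<Rightarrow>\<^sub>L 'b::chilbert_space) set)"
  unfolding bounded_ops_def
  by (intro closed_Collect_all closed_Collect_eq continuous_intros)

lemma min_tensor_subset_bounded_ops: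
  assumes "hilbert_tensor t" and "A \<subseteq> bounded_ops" and "B \<subseteq> bounded_ops"
  shows "min_tensor t A B \<subseteq> bounded_ops"
proof
  fix X assume "X \<in> min_tensor t A B"
  then show "X \<in> bounded_ops"
    unfolding min_tensor_def
  proof (induction rule: closure_cspan_induct)
    case closed
    show ?case using closed_bounded_ops by simp
  next
    case (base X)
    then show ?case
      using assms(2,3) hilbert_tensor.tensor_op_in_bounded_ops[OF assms(1)] by blast
  qed (simp_all add: zero_in_bounded_ops add_in_bounded_ops scaleC_in_bounded_ops)
qed

text \<open>
  The part of the structure used by the argument that is invariant under interchanging the two
  tensor legs.
\<close>
locale tracial_comultiplication = hilbert_tensor t
  for t :: "'h::chilbert_space \<Rightarrow> 'h \<Rightarrow> 'k::chilbert_space" +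
  fixes A :: "('h \<Rightarrow>\<^sub>L 'h) set"
    and \<Delta> :: "('h \<Rightarrow>\<^sub>L 'h) \<Rightarrow> ('k \<Rightarrow>\<^sub>L 'k)"
    and \<xi> :: 'h
  assumes cstar: "unital_cstar_algebra A"
    and comult_hom: "unital_star_hom_on A \<Delta>"
    and comult_range: "a \<in> A \<Longrightarrow> \<Delta> a \<in> min_tensor t A A"
    and norm_GNS_vector: "norm \<xi> = 1"
    and cyclic: "closure {blinfun_apply a \<xi> | a. a \<in> A} = UNIV"
    and haar_right: "a \<in> A \<Longrightarrow> slice_right t \<xi> (\<Delta> a) = vector_state \<xi> a *\<^sub>C id_blinfun"
    and haar_left: "a \<in> A \<Longrightarrow> slice_left t \<xi> (\<Delta> a) = vector_state \<xi> a *\<^sub>C id_blinfun"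
    and haar_trace: "a \<in> A \<Longrightarrow> b \<in> A \<Longrightarrow> vector_state \<xi> (a o\<^sub>L b) = vector_state \<xi> (b o\<^sub>L a)"
begin

text \<open>The flip exchanges \<open>haar_right\<close> and \<open>haar_left\<close>; all other
  axioms are symmetric in the two legs.\<close>

lemma flip_comult: "tracial_comultiplication (\<lambda>x y. t y x) A \<Delta> \<xi>"
  by (intro tracial_comultiplication.intro flip tracial_comultiplication_axioms.intro)
    (simp_all add: cstar comult_hom comult_range norm_GNS_vector cyclic haar_right haar_left
      haar_trace min_tensor_flip slice_flip)

section \<open>The tracial Haar state on its GNS space\<close>

lemma A_subset: "A \<subseteq> bounded_ops"
  and id_in_A: "id_blinfun \<in> A"
  and add_in_A: "a \<in> A \<Longrightarrow> b \<in> A \<Longrightarrow> a + b \<in> A"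
  and scaleC_in_A: "a \<in> A \<Longrightarrow> c *\<^sub>C a \<in> A"
  and compose_in_A: "a \<in> A \<Longrightarrow> b \<in> A \<Longrightarrow> a o\<^sub>L b \<in> A"
  and adj_in_A: "a \<in> A \<Longrightarrow> adj a \<in> A"
  and closed_A: "closed A"
  using cstar by (simp_all add: unital_cstar_algebra_def)

lemma A_bounded [simp]: "a \<in> A \<Longrightarrow> a \<in> bounded_ops"
  using A_subset by blast

lemma zero_in_A: "0 \<in> A"
  using scaleC_in_A[OF id_in_A, of 0] by simp

lemma diff_in_A: "a \<in> A \<Longrightarrow> b \<in> A \<Longrightarrow> a - b \<in> A"
  using add_in_A[OF _ scaleC_in_A[of b "-1"], of a] by (simp add: scaleC_minus1)

lemma comult_compose: "a \<in> A \<Longrightarrow> b \<in> A \<Longrightarrow> \<Delta> (a o\<^sub>L b) = \<Delta> a o\<^sub>L \<Delta> b"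
  and comult_adj: "a \<in> A \<Longrightarrow> \<Delta> (adj a) = adj (\<Delta> a)"
  using comult_hom by (simp_all add: unital_star_hom_on_def)

lemma comult_bounded: "a \<in> A \<Longrightarrow> \<Delta> a \<in> bounded_ops"
  using min_tensor_subset_bounded_ops[OF hilbert_tensor_axioms A_subset A_subset] comult_range
  by blast

lemma cinner_comult_left:
  "a \<in> A \<Longrightarrow> cinner (blinfun_apply (\<Delta> a) p) q = cinner p (blinfun_apply (\<Delta> (adj a)) q)"
  by (simp add: comult_adj cinner_adj_right comult_bounded)

lemma comult_haar_right: "a \<in> A \<Longrightarrow>
    cinner (t x \<xi>) (blinfun_apply (\<Delta> a) (t y \<xi>)) = cinner \<xi> (blinfun_apply a \<xi>) * cinner x y"
  using slice_right_spec[OF comult_bounded, of a x \<xi> y]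
  by (simp add: haar_right vector_state_def cinner_scaleC_right)

lemma comult_haar_left: "a \<in> A \<Longrightarrow>
    cinner (t \<xi> x) (blinfun_apply (\<Delta> a) (t \<xi> y)) = cinner \<xi> (blinfun_apply a \<xi>) * cinner x y"
  using slice_left_spec[OF comult_bounded, of a x \<xi> y]
  by (simp add: haar_left vector_state_def cinner_scaleC_right)

lemma haar_commute: "a \<in> A \<Longrightarrow> b \<in> A \<Longrightarrow>
    cinner \<xi> (blinfun_apply a (blinfun_apply b \<xi>)) = cinner \<xi> (blinfun_apply b (blinfun_apply a \<xi>))"
  using haar_trace[of a b] by (simp add: vector_state_def)

lemma norm_adj_GNS: "a \<in> A \<Longrightarrow> norm (blinfun_apply (adj a) \<xi>) = norm (blinfun_apply a \<xi>)"
proof -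
  assume a: "a \<in> A"
  have "cinner (blinfun_apply (adj a) \<xi>) (blinfun_apply (adj a) \<xi>) =
      cinner \<xi> (blinfun_apply a (blinfun_apply (adj a) \<xi>))"
    using a by (intro cinner_adj_left) simp
  also have "\<dots> = cinner (blinfun_apply a \<xi>) (blinfun_apply a \<xi>)"
    using haar_commute[OF a adj_in_A[OF a]] a by (simp add: cinner_adj_right)
  finally have "complex_of_real ((norm (blinfun_apply (adj a) \<xi>))\<^sup>2) = of_real ((norm (blinfun_apply a \<xi>))\<^sup>2)"
    by (simp only: cinner_self)
  then show ?thesis
    by (simp only: of_real_eq_iff power2_eq_iff_nonneg norm_ge_zero)
qed

lemma cyclic_induct:
  assumes "closed {x. P x}" and "\<And>a. a \<in> A \<Longrightarrow> P (blinfun_apply a \<xi>)"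
  shows "P x"
proof -
  have "closure {blinfun_apply a \<xi> | a. a \<in> A} \<subseteq> {x. P x}"
    using assms by (intro closure_minimal) auto
  then show ?thesis
    using cyclic by auto
qed

lemma cyclic_sequence:
  "\<exists>c. (\<forall>n. c n \<in> A) \<and> (\<lambda>n. blinfun_apply (c n) \<xi>) \<longlonglongrightarrow> x"
proof -
  have "x \<in> closure {blinfun_apply a \<xi> | a. a \<in> A}"
    by (simp only: cyclic UNIV_I)
  then obtain u where u: "\<forall>n. u n \<in> {blinfun_apply a \<xi> | a. a \<in> A}" "u \<longlonglongrightarrow> x"
    unfolding closure_sequential by blast
  then have "\<forall>n. \<exists>a. a \<in> A \<and> u n = blinfun_apply a \<xi>" by blast
  then obtain c where c: "\<And>n. c n \<in> A" "\<And>n. u n = blinfun_apply (c n) \<xi>" by metis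
  have "u = (\<lambda>n. blinfun_apply (c n) \<xi>)"
    by (rule ext) (rule c(2))
  then show ?thesis
    using c(1) u(2) by (intro exI[of _ c]) simp
qed

text \<open>The vector state of \<open>t \<xi> \<xi>\<close> is the tensor product of two traces. By
  linearity and continuity in \<open>X\<close> and then in \<open>Y\<close> it is enough to take
  elementary tensors, where the claim is \<open>haar_commute\<close> on each leg.\<close>

lemma tensor_trace:
  assumes X: "X \<in> min_tensor t A A" and Y: "Y \<in> min_tensor t A A" and "m \<in> A" "n \<in> A"
  shows "cinner (t \<xi> \<xi>) (blinfun_apply X (blinfun_apply (tensor_op t m n) (blinfun_apply Y (t \<xi> \<xi>))))
    = cinner (t \<xi> \<xi>) (blinfun_apply (tensor_op t m n) (blinfun_apply Y (blinfun_apply X (t \<xi> \<xi>))))"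
  using X unfolding min_tensor_def
proof (induction rule: closure_cspan_induct)
  case closed
  show ?case
    by (intro closed_Collect_eq continuous_intros)
next
  case (base X)
  then obtain a b where X: "X = tensor_op t a b" "a \<in> A" "b \<in> A" by blast
  show ?case
    using Y unfolding min_tensor_def
  proof (induction rule: closure_cspan_induct)
    case closed
    show ?case
      by (intro closed_Collect_eq continuous_intros)
  next
    case (base Y)
    then obtain c d where Y: "Y = tensor_op t c d" "c \<in> A" "d \<in> A" by blast
    show ?case
      using haar_commute[of a "m o\<^sub>L c"] haar_commute[of b "n o\<^sub>L d"]
      by (simp add: X Y assms(3,4) tensor_op_apply cinner_tensor compose_in_A)
  next
    case (scale c Y)
    have "tensor_op t m n \<in> bounded_ops" "X \<in> bounded_ops"
      by (simp_all add: X assms(3,4) tensor_op_in_bounded_ops)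
    then show ?case
      by (simp add: scale bounded_opsD cinner_scaleC_right)
  qed (simp_all add: blinfun.add_left blinfun.add_right cinner_add_right)
next
  case (scale c X)
  have "tensor_op t m n \<in> bounded_ops" "Y \<in> bounded_ops"
    using min_tensor_subset_bounded_ops[OF hilbert_tensor_axioms A_subset A_subset] Y
    by (auto simp: assms(3,4) tensor_op_in_bounded_ops)
  then show ?case
    by (simp add: scale bounded_opsD cinner_scaleC_right)
qed (simp_all add: blinfun.add_left blinfun.add_right cinner_add_right)

text \<open>\<open>R\<close> is right multiplication by \<open>y\<close>, sending
  \<open>a \<xi>\<close> to \<open>a y \<xi>\<close>; traciality makes it bounded. Such operators
  test elements of \<open>L_infinity A\<close> on the dense set of vectors
  \<open>y \<xi>\<close>.\<close>

lemma right_multiplication_exists: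
  assumes y: "y \<in> A"
  shows "\<exists>R\<in>commutant A. blinfun_apply R \<xi> = blinfun_apply y \<xi>"
proof -
  let ?G = "{(blinfun_apply a \<xi>, blinfun_apply a (blinfun_apply y \<xi>)) | a. a \<in> A}"
  have bound: "norm v \<le> norm (adj y) * norm u" if uv: "(u, v) \<in> cspan ?G" for u v
  proof -
    \<comment> \<open>As \<open>A\<close> is a linear space, the graph equals its own span, so the
      bound need only be checked on single elements.\<close>
    have "\<exists>a\<in>A. p = (blinfun_apply a \<xi>, blinfun_apply a (blinfun_apply y \<xi>))" if "p \<in> cspan ?G" for p
      using that
    proof (induction rule: complex_vector.span_induct_alt)
      case base
      show ?case by (rule bexI[OF _ zero_in_A]) (simp add: zero_prod_def)
    next
      case (step c p q)
      then obtain a b where "a \<in> A" "b \<in> A"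
        "p = (blinfun_apply a \<xi>, blinfun_apply a (blinfun_apply y \<xi>))"
        "q = (blinfun_apply b \<xi>, blinfun_apply b (blinfun_apply y \<xi>))" by blast
      then show ?case
        by (intro bexI[of _ "c *\<^sub>C a + b"] add_in_A scaleC_in_A)
          (simp_all add: scaleC_prod_def blinfun.add_left)
    qed
    then obtain a where a: "a \<in> A" "u = blinfun_apply a \<xi>" "v = blinfun_apply a (blinfun_apply y \<xi>)"
      using uv by blast
    \<comment> \<open>Passing to the adjoint turns \<open>a y\<close> into \<open>y* a*\<close>,
      where \<open>y*\<close> stands on the left and its operator norm can be used; a second passage
      to the adjoint restores \<open>a \<xi>\<close>.\<close>
    have "norm v = norm (blinfun_apply (adj (a o\<^sub>L y)) \<xi>)"
      using norm_adj_GNS[OF compose_in_A[OF a(1) y]] by (simp add: a(3))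
    also have "\<dots> = norm (blinfun_apply (adj y) (blinfun_apply (adj a) \<xi>))"
      by (simp add: adj_compose a(1) y)
    also have "\<dots> \<le> norm (adj y) * norm (blinfun_apply (adj a) \<xi>)"
      by (rule norm_blinfun)
    finally show ?thesis
      by (simp add: norm_adj_GNS a(1,2))
  qed
  have "fst ` ?G = {blinfun_apply a \<xi> | a. a \<in> A}"
    by (force simp: image_iff)
  moreover have "closure {blinfun_apply a \<xi> | a. a \<in> A} \<subseteq> closure (cspan {blinfun_apply a \<xi> | a. a \<in> A})"
    by (intro closure_mono subsetI complex_vector.span_base)
  ultimately have total: "closure (cspan (fst ` ?G)) = UNIV"
    using cyclic by (simp only: top.extremum_unique)
  obtain R where R: "R \<in> bounded_ops" "\<forall>u v. (u, v) \<in> ?G \<longrightarrow> blinfun_apply R u = v"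
    using blinfun_extension[OF bound total] by blast
  have Ra: "blinfun_apply R (blinfun_apply a \<xi>) = blinfun_apply a (blinfun_apply y \<xi>)" if "a \<in> A" for a
    by (rule R(2)[rule_format]) (use that in blast)
  have "R o\<^sub>L a = a o\<^sub>L R" if a: "a \<in> A" for a
  proof (rule blinfun_eqI)
    show "blinfun_apply (R o\<^sub>L a) x = blinfun_apply (a o\<^sub>L R) x" for x
    proof (rule cyclic_induct[of "\<lambda>x. blinfun_apply (R o\<^sub>L a) x = blinfun_apply (a o\<^sub>L R) x"])
      show "blinfun_apply (R o\<^sub>L a) (blinfun_apply c \<xi>) = blinfun_apply (a o\<^sub>L R) (blinfun_apply c \<xi>)"
        if "c \<in> A" for c
        using Ra[OF that] Ra[OF compose_in_A[OF a that]] by simp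
    qed (intro closed_Collect_eq continuous_intros)
  qed
  then have "R \<in> commutant A"
    by (simp add: commutant_def R(1))
  then show ?thesis
    using Ra[OF id_in_A] by auto
qed

lemma L_infinity_subset: "L_infinity A \<subseteq> bounded_ops"
  by (auto simp: L_infinity_def commutant_def)

lemma adj_in_L_infinity: "b \<in> L_infinity A \<Longrightarrow> adj b \<in> L_infinity A"
  unfolding L_infinity_def
  by (rule adj_in_commutant) (use adj_in_commutant[OF A_subset adj_in_A] in \<open>auto simp: commutant_def\<close>)

end

text \<open>Density of \<open>A \<xi>\<close>, used in one leg at a time, puts all elementary
  tensors into \<open>S\<close>, and these are total.\<close>

lemma (in tracial_comultiplication) closed_subspace_eq_UNIV:
  assumes "closed S" "0 \<in> S" "\<And>p q. p \<in> S \<Longrightarrow> q \<in> S \<Longrightarrow> p + q \<in> S" "\<And>c p. p \<in> S \<Longrightarrow> c *\<^sub>C p \<in> S"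
    and "\<And>a b. a \<in> A \<Longrightarrow> b \<in> A \<Longrightarrow> t (blinfun_apply a \<xi>) (blinfun_apply b \<xi>) \<in> S"
  shows "S = UNIV"
proof -
  have cont: "closed {x. t x y \<in> S}" "closed {y. t x y \<in> S}" for x y
    using closed_vimage[OF assms(1) linear_continuous_on[OF bounded_linear_left[of y]]]
      closed_vimage[OF assms(1) linear_continuous_on[OF bounded_linear_right[of x]]]
    by (simp_all add: vimage_def)
  have "t x y \<in> S" for x y
    by (rule cyclic_induct[of "\<lambda>x. t x y \<in> S"], rule cont)
      (rule cyclic_induct[of "\<lambda>y. t _ y \<in> S"], rule cont, rule assms(5))
  moreover have "p \<in> closure (cspan {t x y | x y. True})" for p
    by (simp only: dense UNIV_I)
  then have "p \<in> S" if "\<And>x y. t x y \<in> S" for p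
    by (induction rule: closure_cspan_induct) (use assms that in auto)
  ultimately show ?thesis by blast
qed

text \<open>
  \<open>V\<close> is the isometry \<open>a\<xi> \<mapsto> \<Delta>(a)(\<xi> \<otimes> \<xi>)\<close>; compression by it is the inverse of the coproduct
  composed with the trace-preserving conditional expectation onto its image.
\<close>
locale comultiplication_isometry = tracial_comultiplication t A \<Delta> \<xi>
  for t :: "'h::chilbert_space \<Rightarrow> 'h \<Rightarrow> 'k::chilbert_space"
    and A \<Delta> \<xi> +
  fixes V :: "'h \<Rightarrow>\<^sub>L 'k"
  assumes V_bounded: "V \<in> bounded_ops"
    and V_apply: "a \<in> A \<Longrightarrow> blinfun_apply V (blinfun_apply a \<xi>) = blinfun_apply (\<Delta> a) (t \<xi> \<xi>)"
begin

lemma flip_isometry: "comultiplication_isometry (\<lambda>x y. t y x) A \<Delta> \<xi> V"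
  by (intro comultiplication_isometry.intro flip_comult comultiplication_isometry_axioms.intro)
    (simp_all add: V_bounded V_apply)

text \<open>On vectors \<open>c \<xi>\<close> this is multiplicativity of \<open>\<Delta>\<close>;
  density does the rest.\<close>

lemma comult_V: "a \<in> A \<Longrightarrow> blinfun_apply (\<Delta> a) (blinfun_apply V x) = blinfun_apply V (blinfun_apply a x)"
proof (rule cyclic_induct[of "\<lambda>x. blinfun_apply (\<Delta> a) (blinfun_apply V x) = blinfun_apply V (blinfun_apply a x)"])
  show "blinfun_apply (\<Delta> a) (blinfun_apply V (blinfun_apply c \<xi>)) =
      blinfun_apply V (blinfun_apply a (blinfun_apply c \<xi>))" if "a \<in> A" "c \<in> A" for c
    using V_apply[OF compose_in_A[OF that]] that by (simp add: V_apply comult_compose)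
qed (intro closed_Collect_eq continuous_intros)

lemma cinner_V_id_tensor_V:
  assumes m: "m \<in> A"
  shows "cinner (blinfun_apply V x) (blinfun_apply (tensor_op t id_blinfun m) (blinfun_apply V y)) =
    cinner \<xi> (blinfun_apply m \<xi>) * cinner x y"
proof (rule cyclic_induct[of "\<lambda>x. cinner (blinfun_apply V x)
    (blinfun_apply (tensor_op t id_blinfun m) (blinfun_apply V y)) = _ * cinner x y"])
  show "closed {x. cinner (blinfun_apply V x) (blinfun_apply (tensor_op t id_blinfun m) (blinfun_apply V y))
      = cinner \<xi> (blinfun_apply m \<xi>) * cinner x y}"
    by (intro closed_Collect_eq continuous_intros)
  fix c assume c: "c \<in> A"
  show "cinner (blinfun_apply V (blinfun_apply c \<xi>))
      (blinfun_apply (tensor_op t id_blinfun m) (blinfun_apply V y)) =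
    cinner \<xi> (blinfun_apply m \<xi>) * cinner (blinfun_apply c \<xi>) y"
  proof (rule cyclic_induct[of "\<lambda>y. cinner (blinfun_apply V _)
      (blinfun_apply (tensor_op t id_blinfun m) (blinfun_apply V y)) = _ * cinner _ y"])
    show "closed {y. cinner (blinfun_apply V (blinfun_apply c \<xi>))
        (blinfun_apply (tensor_op t id_blinfun m) (blinfun_apply V y)) =
      cinner \<xi> (blinfun_apply m \<xi>) * cinner (blinfun_apply c \<xi>) y}"
      by (intro closed_Collect_eq continuous_intros)
    fix d assume d: "d \<in> A"
    \<comment> \<open>Moving \<open>m\<close> to the left vector produces the form
      \<open>t \<xi> _\<close> that \<open>comult_haar_left\<close> requires.\<close>
    have adjZ: "cinner (t \<xi> \<xi>) (blinfun_apply (tensor_op t id_blinfun m) p) =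
        cinner (t \<xi> (blinfun_apply (adj m) \<xi>)) p" for p
    proof -
      have "t \<xi> (blinfun_apply (adj m) \<xi>) = blinfun_apply (adj (tensor_op t id_blinfun m)) (t \<xi> \<xi>)"
        using m by (simp add: adj_tensor_op tensor_op_apply adj_in_bounded_ops)
      then show ?thesis
        using m by (simp add: cinner_adj_left tensor_op_in_bounded_ops)
    qed
    have "cinner (blinfun_apply V (blinfun_apply c \<xi>))
        (blinfun_apply (tensor_op t id_blinfun m) (blinfun_apply V (blinfun_apply d \<xi>))) =
      cinner (t \<xi> \<xi>) (blinfun_apply (\<Delta> (adj c)) (blinfun_apply (tensor_op t id_blinfun m)
        (blinfun_apply (\<Delta> d) (t \<xi> \<xi>))))"
      using c d by (simp add: V_apply cinner_comult_left)
    also have "\<dots> = cinner (t \<xi> \<xi>) (blinfun_apply (tensor_op t id_blinfun m)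
        (blinfun_apply (\<Delta> d) (blinfun_apply (\<Delta> (adj c)) (t \<xi> \<xi>))))"
      using c d m by (intro tensor_trace comult_range adj_in_A id_in_A)
    also have "\<dots> = cinner (t \<xi> (blinfun_apply (adj m) \<xi>)) (blinfun_apply (\<Delta> (d o\<^sub>L adj c)) (t \<xi> \<xi>))"
      using c d by (simp add: adjZ comult_compose adj_in_A)
    also have "\<dots> = cinner \<xi> (blinfun_apply d (blinfun_apply (adj c) \<xi>)) * cinner (blinfun_apply (adj m) \<xi>) \<xi>"
      using c d by (simp add: comult_haar_left compose_in_A adj_in_A)
    also have "\<dots> = cinner \<xi> (blinfun_apply m \<xi>) * cinner (blinfun_apply c \<xi>) (blinfun_apply d \<xi>)"
      using c d m by (simp add: haar_commute[of d] adj_in_A cinner_adj_right cinner_adj_left)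
    finally show "cinner (blinfun_apply V (blinfun_apply c \<xi>))
        (blinfun_apply (tensor_op t id_blinfun m) (blinfun_apply V (blinfun_apply d \<xi>))) =
      cinner \<xi> (blinfun_apply m \<xi>) * cinner (blinfun_apply c \<xi>) (blinfun_apply d \<xi>)" .
  qed
qed

text \<open>Apply the preceding identity to \<open>m* m\<close>, using
  \<open>h(m* m) = (norm (m \<xi>))^2\<close>. Operator norms are thus controlled by GNS vectors
  alone.\<close>

lemma norm_id_tensor_V:
  assumes m: "m \<in> A"
  shows "norm (tensor_op t id_blinfun m o\<^sub>L V) \<le> norm (blinfun_apply m \<xi>)"
proof (rule norm_blinfun_bound)
  fix y
  let ?Z = "tensor_op t id_blinfun m"
  have Z: "adj ?Z o\<^sub>L ?Z = tensor_op t id_blinfun (adj m o\<^sub>L m)"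
    using m by (simp add: adj_tensor_op tensor_op_compose adj_in_bounded_ops)
  have "complex_of_real ((norm (blinfun_apply (?Z o\<^sub>L V) y))\<^sup>2) =
      cinner (blinfun_apply V y) (blinfun_apply (adj ?Z o\<^sub>L ?Z) (blinfun_apply V y))"
    using m by (simp add: cinner_adj_right tensor_op_in_bounded_ops cinner_self)
  also have "\<dots> = cinner \<xi> (blinfun_apply (adj m o\<^sub>L m) \<xi>) * cinner y y"
    unfolding Z by (rule cinner_V_id_tensor_V) (intro compose_in_A adj_in_A m)
  also have "\<dots> = of_real ((norm (blinfun_apply m \<xi>) * norm y)\<^sup>2)"
    using m by (simp add: cinner_adj_right cinner_self power_mult_distrib)
  finally have "(norm (blinfun_apply (?Z o\<^sub>L V) y))\<^sup>2 = (norm (blinfun_apply m \<xi>) * norm y)\<^sup>2"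
    by (simp only: of_real_eq_iff)
  then show "norm (blinfun_apply (?Z o\<^sub>L V) y) \<le> norm (blinfun_apply m \<xi>) * norm y"
    by (simp add: power2_eq_iff_nonneg)
qed simp

text \<open>
  Approximating \<open>b\<^sup>*\<xi>\<close> by \<open>c\<^sub>n\<xi>\<close>, rather than \<open>b\<xi>\<close>, gives weak convergence of \<open>c\<^sub>n\<^sup>*\<close> to \<open>b\<close> for
  free: right multiplications lie in the commutant, so \<open>c\<^sub>n(a\<xi>) \<rightarrow> b\<^sup>*(a\<xi>)\<close> for every \<open>a \<in> A\<close>.
\<close>
lemma id_tensor_L_infinity_V_approx:
  assumes b: "b \<in> L_infinity A"
  obtains B where "\<And>n. B n \<in> A"
    "(\<lambda>n. tensor_op t id_blinfun (B n) o\<^sub>L V) \<longlonglongrightarrow> (tensor_op t id_blinfun b o\<^sub>L V)"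
proof -
  have b': "b \<in> bounded_ops"
    using b L_infinity_subset by blast
  obtain c where c: "\<And>n. c n \<in> A" "(\<lambda>n. blinfun_apply (c n) \<xi>) \<longlonglongrightarrow> blinfun_apply (adj b) \<xi>"
    using cyclic_sequence[of "blinfun_apply (adj b) \<xi>"] by blast
  define T where "T n = tensor_op t id_blinfun (adj (c n)) o\<^sub>L V" for n
  \<comment> \<open>This makes \<open>T\<close> Cauchy in operator norm although the
    \<open>c n\<close> converge only on \<open>\<xi>\<close>; traciality removes the
    adjoint.\<close>
  have T_diff: "norm (T i - T j) \<le> norm (blinfun_apply (c i) \<xi> - blinfun_apply (c j) \<xi>)" for i j
  proof -
    have "T i - T j = tensor_op t id_blinfun (adj (c i - c j)) o\<^sub>L V"
      using c(1) by (intro blinfun_eqI)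
        (simp add: T_def adj_diff tensor_op_diff_right adj_in_bounded_ops blinfun.diff_left)
    also have "norm \<dots> \<le> norm (blinfun_apply (adj (c i - c j)) \<xi>)"
      by (intro norm_id_tensor_V adj_in_A diff_in_A c(1))
    finally show ?thesis
      by (simp add: norm_adj_GNS diff_in_A c(1) blinfun.diff_left)
  qed
  have "Cauchy T"
  proof (rule CauchyI)
    fix e :: real assume "e > 0"
    then obtain M where "\<And>i j. i \<ge> M \<Longrightarrow> j \<ge> M \<Longrightarrow> norm (blinfun_apply (c i) \<xi> - blinfun_apply (c j) \<xi>) < e"
      using CauchyD[OF LIMSEQ_imp_Cauchy[OF c(2)]] by blast
    then show "\<exists>M. \<forall>i\<ge>M. \<forall>j\<ge>M. norm (T i - T j) < e"
      using T_diff le_less_trans by blast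
  qed
  then obtain \<Theta> where \<Theta>: "T \<longlonglongrightarrow> \<Theta>"
    using Cauchy_convergent convergent_def by blast
  \<comment> \<open>The norm limit is identified weakly, by testing against the vectors
    \<open>t x (a \<xi>)\<close>.\<close>
  have "\<Theta> = tensor_op t id_blinfun b o\<^sub>L V"
  proof (rule blinfun_eqI, rule cinner_ext_tensors)
    fix y x z
    show "cinner (t x z) (blinfun_apply \<Theta> y) =
        cinner (t x z) (blinfun_apply (tensor_op t id_blinfun b o\<^sub>L V) y)"
    proof (rule cyclic_induct[of "\<lambda>z. cinner (t x z) _ = cinner (t x z) _"])
      show "closed {z. cinner (t x z) (blinfun_apply \<Theta> y) =
          cinner (t x z) (blinfun_apply (tensor_op t id_blinfun b o\<^sub>L V) y)}"
        by (intro closed_Collect_eq continuous_on_cinner_left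
            bounded_linear.continuous_on[OF bounded_linear_right] continuous_on_id)
    next
      fix a assume a: "a \<in> A"
      obtain R where R: "R \<in> commutant A" "blinfun_apply R \<xi> = blinfun_apply a \<xi>"
        using right_multiplication_exists[OF a] by blast
      \<comment> \<open>Used for \<open>d = c n\<close> and for \<open>d = adj b\<close>. The former
        commutes with \<open>R\<close> because \<open>R\<close> lies in the commutant of
        \<open>A\<close>, the latter because \<open>adj b\<close> lies in the double
        commutant.\<close>
      have swap: "cinner (t x (blinfun_apply a \<xi>)) (blinfun_apply (tensor_op t id_blinfun (adj d)) p) =
          cinner (t x (blinfun_apply R (blinfun_apply d \<xi>))) p"
        if d: "d \<in> bounded_ops" and comm: "R o\<^sub>L d = d o\<^sub>L R" for d p
      proof -
        have "tensor_op t id_blinfun (adj d) = adj (tensor_op t id_blinfun d)"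
          using d by (simp add: adj_tensor_op)
        moreover have "blinfun_apply R (blinfun_apply d \<xi>) = blinfun_apply d (blinfun_apply R \<xi>)"
          using comm by (metis blinfun_compose.rep_eq comp_apply)
        ultimately show ?thesis
          using d by (simp add: cinner_adj_right tensor_op_in_bounded_ops tensor_op_apply R(2))
      qed
      have "(\<lambda>n. cinner (t x (blinfun_apply a \<xi>)) (blinfun_apply (T n) y))
          \<longlonglongrightarrow> cinner (t x (blinfun_apply a \<xi>)) (blinfun_apply \<Theta> y)"
        by (intro bounded_linear.tendsto[OF bounded_linear_cinner_right] blinfun.tendsto \<Theta> tendsto_const)
      moreover have "cinner (t x (blinfun_apply a \<xi>)) (blinfun_apply (T n) y) =
          cinner (t x (blinfun_apply R (blinfun_apply (c n) \<xi>))) (blinfun_apply V y)" for n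
        using R(1) c(1)[of n] by (simp add: T_def swap commutant_def)
      moreover have "(\<lambda>n. cinner (t x (blinfun_apply R (blinfun_apply (c n) \<xi>))) (blinfun_apply V y))
          \<longlonglongrightarrow> cinner (t x (blinfun_apply R (blinfun_apply (adj b) \<xi>))) (blinfun_apply V y)"
        by (intro bounded_linear.tendsto[OF bounded_linear_cinner_left]
            bounded_linear.tendsto[OF bounded_linear_right] blinfun.tendsto tendsto_const c(2))
      moreover have "cinner (t x (blinfun_apply R (blinfun_apply (adj b) \<xi>))) (blinfun_apply V y) =
          cinner (t x (blinfun_apply a \<xi>)) (blinfun_apply (tensor_op t id_blinfun b o\<^sub>L V) y)"
      proof -
        have "R o\<^sub>L adj b = adj b o\<^sub>L R"
          using adj_in_L_infinity[OF b] R(1) by (simp add: L_infinity_def commutant_def[of "commutant A"])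
        then show ?thesis
          using swap[of "adj b"] b' by (simp add: adj_in_bounded_ops adj_adj)
      qed
      ultimately show "cinner (t x (blinfun_apply a \<xi>)) (blinfun_apply \<Theta> y) =
          cinner (t x (blinfun_apply a \<xi>)) (blinfun_apply (tensor_op t id_blinfun b o\<^sub>L V) y)"
        by (simp add: LIMSEQ_unique)
    qed
  qed
  then show thesis
    using that[of "\<lambda>n. adj (c n)"] c(1) \<Theta> adj_in_A by (simp add: T_def[abs_def])
qed


text \<open>The case \<open>m = 1\<close> of \<open>cinner_V_id_tensor_V\<close>, as
  \<open>\<xi>\<close> is a unit vector.\<close>

lemma adj_V_V: "adj V o\<^sub>L V = id_blinfun"
proof (rule blinfun_eqI, rule cinner_ext)
  fix x y
  have "tensor_op t id_blinfun id_blinfun = id_blinfun"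
    by (rule blinfun_eq_on_tensors) (simp add: tensor_op_apply)
  then have "cinner (blinfun_apply V y) (blinfun_apply V x) = cinner y x"
    using cinner_V_id_tensor_V[OF id_in_A, of y x] norm_GNS_vector by (simp add: cinner_self)
  then show "cinner y (blinfun_apply (adj V o\<^sub>L V) x) = cinner y (blinfun_apply id_blinfun x)"
    by (simp add: cinner_adj_right[OF V_bounded])
qed

section \<open>Compression by the isometry takes values in A\<close>

lemma compress_zero: "adj V o\<^sub>L 0 o\<^sub>L V = 0"
  and compress_add: "adj V o\<^sub>L (X + Y) o\<^sub>L V = (adj V o\<^sub>L X o\<^sub>L V) + (adj V o\<^sub>L Y o\<^sub>L V)"
  and compress_scaleC: "adj V o\<^sub>L (c *\<^sub>C X) o\<^sub>L V = c *\<^sub>C (adj V o\<^sub>L X o\<^sub>L V)"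
  by (auto intro!: blinfun_eqI simp: blinfun.add_left blinfun.add_right
      bounded_opsD[OF adj_in_bounded_ops[OF V_bounded]])

lemma closed_compress_in_A: "closed {X. adj V o\<^sub>L X o\<^sub>L V \<in> A}"
proof -
  have "continuous_on UNIV (\<lambda>X. adj V o\<^sub>L X o\<^sub>L V)"
    by (intro bounded_bilinear.continuous_on[OF bounded_bilinear_blinfun_compose] continuous_intros)
  then show ?thesis
    using closed_vimage[OF closed_A] by (simp add: vimage_def)
qed

text \<open>The intertwining relation pulls \<open>\<Delta>(n)\<close> out of the compression as
  \<open>n\<close>; what remains is the scalar \<open>h(m)\<close>, by
  \<open>cinner_V_id_tensor_V\<close> for the flipped legs.\<close>

lemma compress_in_A:
  assumes "X \<in> closure (cspan {\<Delta> n o\<^sub>L tensor_op t m id_blinfun | n m. n \<in> A \<and> m \<in> A})"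
  shows "adj V o\<^sub>L X o\<^sub>L V \<in> A"
  using assms
proof (induction rule: closure_cspan_induct)
  case (base X)
  then obtain n m where X: "X = \<Delta> n o\<^sub>L tensor_op t m id_blinfun" and n: "n \<in> A" and m: "m \<in> A"
    by blast
  have "adj V o\<^sub>L X o\<^sub>L V = cinner \<xi> (blinfun_apply m \<xi>) *\<^sub>C n"
  proof (rule blinfun_eqI, rule cinner_ext)
    fix x y
    have "cinner y (blinfun_apply (adj V o\<^sub>L X o\<^sub>L V) x) =
        cinner (blinfun_apply (\<Delta> (adj n)) (blinfun_apply V y))
          (blinfun_apply (tensor_op t m id_blinfun) (blinfun_apply V x))"
      using n by (simp add: X cinner_adj_right[OF V_bounded] cinner_comult_left adj_in_A adj_adj)
    also have "\<dots> = cinner \<xi> (blinfun_apply m \<xi>) * cinner (blinfun_apply (adj n) y) x"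
      using comultiplication_isometry.cinner_V_id_tensor_V[OF flip_isometry m] n
      by (simp add: comult_V adj_in_A tensor_op_flip)
    finally show "cinner y (blinfun_apply (adj V o\<^sub>L X o\<^sub>L V) x) =
        cinner y (blinfun_apply (cinner \<xi> (blinfun_apply m \<xi>) *\<^sub>C n) x)"
      using n by (simp add: cinner_adj_left cinner_scaleC_right)
  qed
  then show ?case
    by (simp add: scaleC_in_A n)
qed (simp_all add: closed_compress_in_A compress_zero compress_add compress_scaleC zero_in_A
    add_in_A scaleC_in_A)

lemma compress_L_infinity_in_A:
  assumes cancellation:
    "min_tensor t A A \<subseteq> closure (cspan {\<Delta> n o\<^sub>L tensor_op t m id_blinfun | n m. n \<in> A \<and> m \<in> A})"
    and a: "a \<in> L_infinity A" and b: "b \<in> L_infinity A"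
  shows "adj V o\<^sub>L tensor_op t a b o\<^sub>L V \<in> A"
proof -
  \<comment> \<open>Splitting the two legs into separate factors makes each one a norm limit, so
    that the product converges in norm.\<close>
  have factor: "adj V o\<^sub>L tensor_op t (adj c) d o\<^sub>L V =
      adj (tensor_op t c id_blinfun o\<^sub>L V) o\<^sub>L (tensor_op t id_blinfun d o\<^sub>L V)"
    if "c \<in> bounded_ops" "d \<in> bounded_ops" for c d
  proof -
    have "tensor_op t (adj c) d = adj (tensor_op t c id_blinfun) o\<^sub>L tensor_op t id_blinfun d"
      using that by (simp add: adj_tensor_op tensor_op_compose adj_in_bounded_ops)
    then show ?thesis
      using that by (simp add: adj_compose tensor_op_in_bounded_ops V_bounded blinfun_compose_assoc)
  qed
  obtain B where B: "\<And>n. B n \<in> A"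
    "(\<lambda>n. tensor_op t id_blinfun (B n) o\<^sub>L V) \<longlonglongrightarrow> (tensor_op t id_blinfun b o\<^sub>L V)"
    using id_tensor_L_infinity_V_approx[OF b] by blast
  \<comment> \<open>The approximation lemma for the flipped legs, applied to \<open>adj a\<close>
    because this factor occurs under an adjoint.\<close>
  obtain C where C: "\<And>n. C n \<in> A"
    "(\<lambda>n. tensor_op t (C n) id_blinfun o\<^sub>L V) \<longlonglongrightarrow> (tensor_op t (adj a) id_blinfun o\<^sub>L V)"
    using comultiplication_isometry.id_tensor_L_infinity_V_approx[OF flip_isometry adj_in_L_infinity[OF a]]
    unfolding tensor_op_flip by blast
  have ab: "a \<in> bounded_ops" "b \<in> bounded_ops" "adj a \<in> bounded_ops"
    using a b L_infinity_subset adj_in_L_infinity by blast+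
  have "(\<lambda>n. adj (tensor_op t (C n) id_blinfun o\<^sub>L V) o\<^sub>L (tensor_op t id_blinfun (B n) o\<^sub>L V))
      \<longlonglongrightarrow> (adj (tensor_op t (adj a) id_blinfun o\<^sub>L V) o\<^sub>L (tensor_op t id_blinfun b o\<^sub>L V))"
    by (intro bounded_bilinear.tendsto[OF bounded_bilinear_blinfun_compose] tendsto_adj B(2) C(2)
        blinfun_compose_in_bounded_ops tensor_op_in_bounded_ops A_bounded C(1) ab V_bounded
        id_in_bounded_ops)
  then have lim: "(\<lambda>n. adj V o\<^sub>L tensor_op t (adj (C n)) (B n) o\<^sub>L V) \<longlonglongrightarrow> (adj V o\<^sub>L tensor_op t a b o\<^sub>L V)"
    using B(1) C(1) ab factor[of "adj a" b] by (simp add: factor adj_adj)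
  have "tensor_op t (adj (C n)) (B n) \<in> min_tensor t A A" for n
    unfolding min_tensor_def
    using B(1)[of n] adj_in_A[OF C(1)[of n]] by (intro closure_cspan_base) blast
  then have "adj V o\<^sub>L tensor_op t (adj (C n)) (B n) o\<^sub>L V \<in> A" for n
    using cancellation compress_in_A by blast
  then show ?thesis
    by (rule closed_sequentially[OF closed_A _ lim])
qed

end

section \<open>The multiplicative unitary\<close>

context compact_kac_algebra
begin

lemma tracial_comultiplication: "tracial_comultiplication t A \<Delta> \<xi>"
  by (intro tracial_comultiplication.intro t.hilbert_tensor_axioms
      tracial_comultiplication_axioms.intro)
    (simp_all add: cstar comult_hom comult_range norm_GNS_vector cyclic haar_right haar_left haar_trace)

interpretation core: tracial_comultiplication t A \<Delta> \<xi>
  by (rule tracial_comultiplication)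

text \<open>Since \<open>\<Delta>(b)* \<Delta>(b') = \<Delta>(b* b')\<close>, right invariance of
  the Haar state computes the left side. This is the isometry property of \<open>W*\<close>.\<close>

lemma cinner_comult_GNS:
  assumes a: "a \<in> A" "a' \<in> A" and b: "b \<in> A" "b' \<in> A"
  shows "cinner (blinfun_apply (\<Delta> b) (t (blinfun_apply a \<xi>) \<xi>))
      (blinfun_apply (\<Delta> b') (t (blinfun_apply a' \<xi>) \<xi>)) =
    cinner (t (blinfun_apply a \<xi>) (blinfun_apply b \<xi>)) (t (blinfun_apply a' \<xi>) (blinfun_apply b' \<xi>))"
proof -
  have "cinner (blinfun_apply (\<Delta> b) (t (blinfun_apply a \<xi>) \<xi>))
      (blinfun_apply (\<Delta> b') (t (blinfun_apply a' \<xi>) \<xi>)) =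
    cinner (t (blinfun_apply a \<xi>) \<xi>) (blinfun_apply (\<Delta> (adj b o\<^sub>L b')) (t (blinfun_apply a' \<xi>) \<xi>))"
    using b by (simp add: core.cinner_comult_left core.comult_compose core.adj_in_A)
  also have "\<dots> = cinner \<xi> (blinfun_apply (adj b o\<^sub>L b') \<xi>) * cinner (blinfun_apply a \<xi>) (blinfun_apply a' \<xi>)"
    by (rule core.comult_haar_right) (intro core.compose_in_A core.adj_in_A b)
  finally show ?thesis
    using b by (simp add: t.cinner_tensor cinner_adj_right)
qed

text \<open>The vectors \<open>g a b\<close> and \<open>h a b\<close> below are both total and have
  equal inner products, so the correspondence between them extends in both directions: to
  \<open>W\<close> and to its inverse and adjoint \<open>U\<close>.\<close>

lemma mult_unitary_exists:
  "\<exists>U\<in>bounded_ops. adj (mult_unitary t A \<Delta> \<xi>) = U \<and> mult_unitary t A \<Delta> \<xi> o\<^sub>L U = id_blinfun \<and>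
    (\<forall>a\<in>A. \<forall>b\<in>A. blinfun_apply U (t (blinfun_apply a \<xi>) (blinfun_apply b \<xi>)) =
      blinfun_apply (\<Delta> b) (t (blinfun_apply a \<xi>) \<xi>))"
proof -
  define g where "g a b = blinfun_apply (\<Delta> b) (t (blinfun_apply a \<xi>) \<xi>)" for a b
  define h where "h a b = t (blinfun_apply a \<xi>) (blinfun_apply b \<xi>)" for a b
  let ?D = "{g a b | a b. a \<in> A \<and> b \<in> A}" and ?R = "{h a b | a b. a \<in> A \<and> b \<in> A}"
  let ?G = "{(g a b, h a b) | a b. a \<in> A \<and> b \<in> A}" and ?G' = "{(h a b, g a b) | a b. a \<in> A \<and> b \<in> A}"
  have gh: "cinner (g a b) (g a' b') = cinner (h a b) (h a' b')"
    if "a \<in> A" "b \<in> A" "a' \<in> A" "b' \<in> A" for a b a' b'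
    unfolding g_def h_def using that by (intro cinner_comult_GNS)
  have total: "closure (cspan S) = UNIV"
    if "\<And>a b. a \<in> A \<Longrightarrow> b \<in> A \<Longrightarrow> h a b \<in> closure (cspan S)" for S
    by (rule core.closed_subspace_eq_UNIV)
      (auto intro!: closure_cspan_add closure_cspan_scaleC that[unfolded h_def]
        intro: closure_subset[THEN subsetD] complex_vector.span_zero)
  have total_R: "closure (cspan ?R) = UNIV"
    by (rule total, rule closure_cspan_base) blast
  \<comment> \<open>Apply the cancellation property to \<open>t \<xi> \<xi>\<close>: the generators
    \<open>\<Delta>(n)(m \<otimes> 1)\<close> give exactly \<open>g m n\<close>, while
    \<open>a \<otimes> b\<close> gives \<open>h a b\<close>.\<close>
  have total_D: "closure (cspan ?D) = UNIV"
  proof (rule total)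
    fix a b assume ab: "a \<in> A" "b \<in> A"
    have "blinfun_apply X (t \<xi> \<xi>) \<in> closure (cspan ?D)" if "X \<in> min_tensor t A A" for X
      using that unfolding cancellation_left[symmetric]
    proof (induction rule: closure_cspan_induct)
      case closed
      have "continuous_on UNIV (\<lambda>X. blinfun_apply X (t \<xi> \<xi>))"
        by (intro continuous_intros)
      from closed_vimage[OF closed_closure this] show ?case
        by (simp add: vimage_def)
    next
      case (base X)
      then obtain n m where X: "X = \<Delta> n o\<^sub>L tensor_op t m id_blinfun" "n \<in> A" "m \<in> A" by blast
      then have "blinfun_apply X (t \<xi> \<xi>) = g m n"
        by (simp add: g_def t.tensor_op_apply)
      then show ?case
        using X by (intro closure_cspan_base) blast
    next
      case zero
      show ?case
        by (simp add: subsetD[OF closure_subset complex_vector.span_zero])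
    qed (simp_all add: blinfun.add_left closure_cspan_add closure_cspan_scaleC)
    moreover have "tensor_op t a b \<in> min_tensor t A A"
      unfolding min_tensor_def using ab by (intro closure_cspan_base) blast
    ultimately have "blinfun_apply (tensor_op t a b) (t \<xi> \<xi>) \<in> closure (cspan ?D)"
      by blast
    then show "h a b \<in> closure (cspan ?D)"
      using ab by (simp only: h_def t.tensor_op_apply core.A_bounded)
  qed
  \<comment> \<open>Sesquilinearity carries equality of inner products from generators to spans; for
    \<open>p = q\<close> this is the norm bound with constant 1.\<close>
  have pair: "cinner (fst p) (fst q) = cinner (snd p) (snd q)" if "p \<in> cspan ?G" "q \<in> cspan ?G" for p q
    using that(1)
  proof (induction rule: complex_vector.span_induct_alt)
    case (step c p p')
    have "cinner (fst p) (fst q) = cinner (snd p) (snd q)"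
      using that(2)
    proof (induction rule: complex_vector.span_induct_alt)
      case (step d q q')
      then show ?case
        using \<open>p \<in> ?G\<close> gh
        by (auto simp: scaleC_prod_def cinner_add_right cinner_scaleC_right)
    qed simp
    with step show ?case
      by (simp add: scaleC_prod_def cinner_add_left cinner_scaleC_left)
  qed simp
  have norm_eq: "norm u = norm v" if "(u, v) \<in> cspan ?G" for u v
  proof -
    have "complex_of_real ((norm u)\<^sup>2) = of_real ((norm v)\<^sup>2)"
      using pair[OF that that] by (simp only: cinner_self[symmetric] fst_conv snd_conv)
    then show ?thesis
      by (simp only: of_real_eq_iff power2_eq_iff_nonneg norm_ge_zero)
  qed
  \<comment> \<open>Reversed pairs satisfy the same norm equality, which bounds the inverse
    map.\<close>
  have swap: "(snd p, fst p) \<in> cspan ?G" if "p \<in> cspan ?G'" for p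
    using that
  proof (induction rule: complex_vector.span_induct_alt)
    case base
    show ?case
      using complex_vector.span_zero[of ?G] by (simp add: zero_prod_def)
  next
    case (step c p q)
    then have "(snd p, fst p) \<in> ?G"
      by force
    then have "(snd p, fst p) \<in> cspan ?G"
      by (rule complex_vector.span_base)
    from complex_vector.span_add[OF complex_vector.span_scale[OF this, of c] step(2)] show ?case
      by (simp add: scaleC_prod_def)
  qed
  have fst_G: "fst ` ?G = ?D" "fst ` ?G' = ?R"
    by (force simp: image_iff)+
  obtain W where W: "W \<in> bounded_ops" "\<forall>u v. (u, v) \<in> ?G \<longrightarrow> blinfun_apply W u = v"
    using blinfun_extension[of ?G 1] norm_eq total_D unfolding fst_G by force
  obtain U where U: "U \<in> bounded_ops" "\<forall>u v. (u, v) \<in> ?G' \<longrightarrow> blinfun_apply U u = v"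
    using blinfun_extension[of ?G' 1] norm_eq swap total_R unfolding fst_G by force
  have Wg: "blinfun_apply W (g a b) = h a b" and Uh: "blinfun_apply U (h a b) = g a b"
    if "a \<in> A" "b \<in> A" for a b
    using W(2) U(2) that by blast+
  \<comment> \<open>Scalars are absorbed by \<open>a\<close>; \<open>blinfun_eq_on_total\<close>
    asks for this.\<close>
  have scale_D: "c *\<^sub>C s \<in> ?D" if mem: "s \<in> ?D" for c s
  proof -
    obtain a b where s: "s = g a b" "a \<in> A" "b \<in> A" using mem by blast
    then have "c *\<^sub>C s = g (c *\<^sub>C a) b"
      by (simp add: g_def t.scaleC_left bounded_opsD[OF core.comult_bounded])
    then show ?thesis
      using s core.scaleC_in_A by blast
  qed
  have scale_R: "c *\<^sub>C s \<in> ?R" if mem: "s \<in> ?R" for c s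
  proof -
    obtain a b where s: "s = h a b" "a \<in> A" "b \<in> A" using mem by blast
    then have "c *\<^sub>C s = h (c *\<^sub>C a) b"
      by (simp add: h_def t.scaleC_left)
    then show ?thesis
      using s core.scaleC_in_A by blast
  qed
  have "mult_unitary t A \<Delta> \<xi> = W"
    unfolding mult_unitary_def
  proof (rule the_equality)
    show "\<forall>a\<in>A. \<forall>b\<in>A. blinfun_apply W (blinfun_apply (\<Delta> b) (t (blinfun_apply a \<xi>) \<xi>)) =
        t (blinfun_apply a \<xi>) (blinfun_apply b \<xi>)"
      using Wg by (simp add: g_def h_def)
    fix W' assume W': "\<forall>a\<in>A. \<forall>b\<in>A. blinfun_apply W' (blinfun_apply (\<Delta> b) (t (blinfun_apply a \<xi>) \<xi>)) =
        t (blinfun_apply a \<xi>) (blinfun_apply b \<xi>)"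
    show "W' = W"
      by (rule blinfun_eq_on_total[OF total_D scale_D]) (use W' Wg in \<open>auto simp: g_def h_def\<close>)
  qed
  moreover have "W o\<^sub>L U = id_blinfun"
    by (rule blinfun_eq_on_total[OF total_R scale_R]) (auto simp: Wg Uh)
  moreover have "adj W = U"
  proof (rule blinfun_eq_on_total[OF total_R scale_R])
    fix s assume "s \<in> ?R"
    then obtain a b where s: "s = h a b" and ab: "a \<in> A" "b \<in> A" by blast
    show "blinfun_apply (adj W) s = blinfun_apply U s"
    proof (rule cinner_ext_dense[OF total_D])
      fix r assume "r \<in> cspan ?D"
      then show "cinner r (blinfun_apply (adj W) s) = cinner r (blinfun_apply U s)"
      proof (induction rule: complex_vector.span_induct_alt)
        case (step c x y)
        then obtain a' b' where "x = g a' b'" "a' \<in> A" "b' \<in> A" by blast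
        then have "cinner x (blinfun_apply (adj W) s) = cinner x (blinfun_apply U s)"
          using ab by (simp add: cinner_adj_right[OF W(1)] s Wg Uh gh)
        with step show ?case
          by (simp add: cinner_add_left cinner_scaleC_left)
      qed simp
    qed
  qed
  ultimately show ?thesis
    using U(1) Uh by (auto simp: g_def h_def)
qed

lemma comultiplication_isometry_exists:
  "\<exists>V. comultiplication_isometry t A \<Delta> \<xi> V \<and>
    (\<forall>x\<in>bounded_ops. coproduct t A \<Delta> \<xi> x o\<^sub>L V = V o\<^sub>L x)"
proof -
  define W where "W = mult_unitary t A \<Delta> \<xi>"
  obtain U where U: "U \<in> bounded_ops" "adj W = U" "W o\<^sub>L U = id_blinfun"
    "\<And>a b. a \<in> A \<Longrightarrow> b \<in> A \<Longrightarrow> blinfun_apply U (t (blinfun_apply a \<xi>) (blinfun_apply b \<xi>)) =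
      blinfun_apply (\<Delta> b) (t (blinfun_apply a \<xi>) \<xi>)"
    using mult_unitary_exists unfolding W_def by blast
  \<comment> \<open>\<open>V y = W* (\<xi> \<otimes> y)\<close>. Then \<open>W* (1 \<otimes> x) W V
    y = W* (\<xi> \<otimes> x y) = V (x y)\<close> because \<open>W W* = 1\<close>.\<close>
  define V where "V = U o\<^sub>L Blinfun (t \<xi>)"
  have V: "blinfun_apply V y = blinfun_apply U (t \<xi> y)" for y
    by (simp add: V_def bounded_linear_Blinfun_apply[OF t.bounded_linear_right])
  have "V \<in> bounded_ops"
    by (simp add: bounded_ops_def V t.scaleC_right bounded_opsD[OF U(1)])
  moreover have "blinfun_apply V (blinfun_apply a \<xi>) = blinfun_apply (\<Delta> a) (t \<xi> \<xi>)" if "a \<in> A" for a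
    using U(4)[OF core.id_in_A that] by (simp add: V)
  ultimately have "comultiplication_isometry t A \<Delta> \<xi> V"
    by (intro comultiplication_isometry.intro tracial_comultiplication
        comultiplication_isometry_axioms.intro)
  moreover have "coproduct t A \<Delta> \<xi> x o\<^sub>L V = V o\<^sub>L x" if x: "x \<in> bounded_ops" for x
  proof (rule blinfun_eqI)
    fix y
    have "blinfun_apply W (blinfun_apply U p) = p" for p
      using arg_cong[OF U(3), of "\<lambda>T. blinfun_apply T p"] by simp
    then show "blinfun_apply (coproduct t A \<Delta> \<xi> x o\<^sub>L V) y = blinfun_apply (V o\<^sub>L x) y"
      using x by (simp add: coproduct_def W_def[symmetric] U(2) V t.tensor_op_apply)
  qed
  ultimately show ?thesis by blast
qed

end

section \<open>Recovery of x from its coproduct by compression\<close>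

theorem theorem5p1:
  fixes t :: "'h::chilbert_space \<Rightarrow> 'h \<Rightarrow> 'k::chilbert_space"
    and tl :: "'k \<Rightarrow> 'h \<Rightarrow> 'l::chilbert_space"
    and tr :: "'h \<Rightarrow> 'k \<Rightarrow> 'l"
    and A :: "('h \<Rightarrow>\<^sub>L 'h) set"
    and \<Delta> :: "('h \<Rightarrow>\<^sub>L 'h) \<Rightarrow> ('k \<Rightarrow>\<^sub>L 'k)"
    and \<xi> :: 'h
    and x :: "'h \<Rightarrow>\<^sub>L 'h"
  assumes "compact_kac_algebra t tl tr A \<Delta> \<xi>"
    and "x \<in> L_infinity A"
    and "coproduct t A \<Delta> \<xi> x \<in> min_tensor t (L_infinity A) (L_infinity A)"
  shows "x \<in> A"
proof -
  interpret kac: compact_kac_algebra t tl tr A \<Delta> \<xi>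
    by (rule assms(1))
  obtain V where "comultiplication_isometry t A \<Delta> \<xi> V"
    and V: "\<forall>x\<in>bounded_ops. coproduct t A \<Delta> \<xi> x o\<^sub>L V = V o\<^sub>L x"
    using kac.comultiplication_isometry_exists by blast
  then interpret comultiplication_isometry t A \<Delta> \<xi> V
    by blast
  have "adj V o\<^sub>L X o\<^sub>L V \<in> A" if "X \<in> min_tensor t (L_infinity A) (L_infinity A)" for X
    using that unfolding min_tensor_def
  proof (induction rule: closure_cspan_induct)
    case (base X)
    then show ?case
      using compress_L_infinity_in_A kac.cancellation_left by blast
  qed (simp_all add: closed_compress_in_A compress_zero compress_add compress_scaleC zero_in_A
      add_in_A scaleC_in_A)
  \<comment> \<open>The intertwining relation turns the compressed coproduct into
    \<open>V* V x\<close>, which is \<open>x\<close> as \<open>V\<close> is an isometry.\<close>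
  from this[OF assms(3)] have "adj V o\<^sub>L (V o\<^sub>L x) \<in> A"
    using V assms(2) L_infinity_subset by (auto simp: blinfun_compose_assoc)
  then show ?thesis
    by (simp add: adj_V_V flip: blinfun_compose_assoc)
qed

end
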